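(* Let $n\ge 1$, $m\ge 3$ and $k\ge 3$ be integers and let $G=B(n,n,mP_k)$. Then $adern(G)=3$ if $k\ge 5$, or if $m=3$, $k=4$ and $n=1$; $adern(G)=2$ if $m=k=n+1=3$, or $m=k+1=n+3=4$, or $m=k=n+2=3$, or $m\ge k=4$, or ($m=k-1=3$ and $n\ge 2$); and $adern(G)=1$ otherwise.
   Context: All graphs are finite, simple and undirected. For an edge $e$ of a graph $G$, $d(e)$ is the number of edges of $G$ adjacent to $e$. A da-ecard of $G$ is the pair $(d(e),G-e)$ with $G-e$ unlabeled; the da-edeck is the multiset of all da-ecards. The adversary degree associated edge reconstruction number $adern(G)$ is the minimum number $k$ such that every sub-multiset of $k$ da-ecards of $G$ is not contained in the da-edeck of any graph $H\not\cong G$. $B(n,n,mP_k)$ denotes the strong double broom obtained from $m$ internally vertex disjoint paths on $k$ vertices with common ends $u$ and $v$ by attaching $n$ leaves to $u$ and $n$ leaves to $v$. *)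

theory Defs
  imports "HOL-Library.Multiset" "HOL-Library.Extended_Nat"
begin

record 'a ugraph =
  verts :: "'a set"
  edges :: "'a set set"

definition simple_graph :: "'a ugraph \<Rightarrow> bool" where
  "simple_graph G \<longleftrightarrow> finite (verts G) \<and> (\<forall>e\<in>edges G. e \<subseteq> verts G \<and> card e = 2)"

definition graph_iso :: "'a ugraph \<Rightarrow> 'b ugraph \<Rightarrow> bool" where
  "graph_iso G H \<longleftrightarrow>
     (\<exists>f. bij_betw f (verts G) (verts H) \<and> edges H = (\<lambda>e. f ` e) ` edges G)"

definition delete_edge :: "'a ugraph \<Rightarrow> 'a set \<Rightarrow> 'a ugraph" where
  "delete_edge G e = G\<lparr>edges := edges G - {e}\<rparr>"

definition edge_degree :: "'a ugraph \<Rightarrow> 'a set \<Rightarrow> nat" where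
  "edge_degree G e = card {f \<in> edges G. f \<noteq> e \<and> f \<inter> e \<noteq> {}}"

(* The unlabeled graph underlying a finite graph G, represented by its isomorphism class among
   the graphs on natural numbers; every finite graph has an isomorphic copy there, whatever its
   vertex type. *)
definition unlabeled :: "'a ugraph \<Rightarrow> nat ugraph set" where
  "unlabeled G = {H. simple_graph H \<and> graph_iso G H}"

definition da_ecard :: "'a ugraph \<Rightarrow> 'a set \<Rightarrow> nat \<times> nat ugraph set" where
  "da_ecard G e = (edge_degree G e, unlabeled (delete_edge G e))"

definition da_edeck :: "'a ugraph \<Rightarrow> (nat \<times> nat ugraph set) multiset" where
  "da_edeck G = image_mset (da_ecard G) (mset_set (edges G))"

(* k ranges only up to the number of edges, so that a sub-multiset of k da-ecards exists.  If even
   the whole da-edeck is shared with a non-isomorphic graph (as for the star with three edges),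
   then no k qualifies and adern is the infinite value. *)
definition adern :: "'a ugraph \<Rightarrow> enat" where
  "adern G = Inf (enat ` {k. k \<le> size (da_edeck G) \<and>
     (\<forall>C. C \<subseteq># da_edeck G \<and> size C = k \<longrightarrow>
        \<not> (\<exists>H :: nat ugraph. simple_graph H \<and> \<not> graph_iso G H \<and> C \<subseteq># da_edeck H))})"

datatype broom_vertex = HubU | HubV | Inner nat nat | LeafU nat | LeafV nat

(* The j-th vertex (0 \<le> j < k) of the i-th path from HubU to HubV. *)
definition path_vertex :: "nat \<Rightarrow> nat \<Rightarrow> nat \<Rightarrow> broom_vertex" where
  "path_vertex k i j = (if j = 0 then HubU else if j = k - 1 then HubV else Inner i j)"

(* B(p, q, m P_k), with p leaves at HubU and q leaves at HubV; meant for m \<ge> 1 and k \<ge> 3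
   (for k = 2 the m paths would be parallel edges). *)
definition strong_double_broom :: "nat \<Rightarrow> nat \<Rightarrow> nat \<Rightarrow> nat \<Rightarrow> broom_vertex ugraph" where
  "strong_double_broom p q m k =
     \<lparr>verts = {path_vertex k i j |i j. i < m \<and> j < k} \<union> LeafU ` {..<p} \<union> LeafV ` {..<q},
      edges = {{path_vertex k i j, path_vertex k i (Suc j)} |i j. i < m \<and> Suc j < k}
        \<union> {{HubU, LeafU a} |a. a < p} \<union> {{HubV, LeafV b} |b. b < q}\<rparr>"

end

theory Submission
  imports Defs
begin

text \<open>A da-ecard shows the degree of the deleted edge, so the graphs having a given card of $G$ arise
  from it by joining two vertices whose degrees in the card add up to that number; for a broom there are
  few such pairs.  Let $H$ be a graph not isomorphic to $G$ that arises in this way.  If a pendant edge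
  was deleted then $H$ has an isolated vertex, and such graphs occur only when $m + n \le 5$.
  Otherwise all cards common to $G$ and $H$ come from edges of $G$ that are not pendant; in these cards
  every hub has at least $n$ leaf neighbours, and all paths between hubs have length $k - 1$.  In most
  cases $H$ contains a hub with fewer than $n$ leaf neighbours and, ending at this hub, a shorter path
  between the hubs or a cycle through one hub.  A deleted edge giving a common card must lie on this path
  or cycle and create a leaf next to the hub, which leaves one candidate on a path and two on a cycle.
  The maximal number of common cards is attained by closing a cycle through a hub or, if there
  is an isolated vertex, by a suitable edge between two vertices that are not hubs.\<close>

section \<open>Isomorphisms and cards\<close>

text \<open>The degree attached to a card is the sum of the degrees that the two ends of the deleted
  edge have in the card. In a broom it is \<open>m + n - 1\<close> for a pendant edge,
  \<open>m + n\<close> for an edge joining a hub to an inner vertex, and 2 for an edge between inner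
  vertices. A hub alone contributes at least \<open>m + n - 1\<close>, so apart from a few pairs
  containing a hub the new edge joins vertices of degree at most 2; \<open>m + n \<le> 5\<close> is
  just \<open>m + n - 1 \<le> 2 + 2\<close>. The obstacle is to bound the common cards without
  computing the deck of the new graph. For non-pendant edges two invariants of cards suffice as soon
  as the new edge ends in a leaf, since this leaf is lost to its hub. They do not suffice if the new
  edge joins two vertices that have degree 2 in the card. That happens only for
  \<open>m + n = 4\<close>, and there vertices of degree 3 are counted instead. Two common cards,
  where they exist, are copies of one card: the new graph has twin vertices, and an automorphism of
  the broom moves the deleted edge.\<close>

lemma subset_singletonI: "(\<And>x. x \<in> A \<Longrightarrow> x = a) \<Longrightarrow> A \<subseteq> {a}"
  by blast

lemma doubleton_commute: "{x, y} = {y, x}"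
  by (rule insert_commute)

lemma card_image_lessThan_diff_less: "inj f \<Longrightarrow> a < n \<Longrightarrow> card (f ` ({..<n} - {a})) < n" for n :: nat
  by (subst card_image) (auto simp: inj_on_def)

definition iso_map :: "('a \<Rightarrow> 'b) \<Rightarrow> 'a ugraph \<Rightarrow> 'b ugraph \<Rightarrow> bool" where
  "iso_map f X Y \<longleftrightarrow> bij_betw f (verts X) (verts Y) \<and> edges Y = (\<lambda>e. f ` e) ` edges X"

definition nbrs :: "'a ugraph \<Rightarrow> 'a \<Rightarrow> 'a set" where
  "nbrs X x = {y. {x, y} \<in> edges X}"

definition deg :: "'a ugraph \<Rightarrow> 'a \<Rightarrow> nat" where
  "deg X x = card (nbrs X x)"

definition replace_edge :: "'a ugraph \<Rightarrow> 'a set \<Rightarrow> 'a set \<Rightarrow> 'a ugraph" where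
  "replace_edge X e e' = X\<lparr>edges := insert e' (edges X - {e})\<rparr>"

text \<open>A multiset of cards is common to both graphs iff it lies in this intersection, so
  \<open>adern\<close> is one more than the largest overlap with a non-isomorphic graph, as long as
  that many cards exist. The vertex types may differ, which lets witnesses live on
  \<open>broom_vertex\<close> while \<open>adern\<close> ranges over graphs on
  \<open>nat\<close>.\<close>

definition overlap :: "'a ugraph \<Rightarrow> 'b ugraph \<Rightarrow> nat" where
  "overlap X Y = size (da_edeck X \<inter># da_edeck Y)"

lemma graph_iso_iff_iso_map: "graph_iso X Y \<longleftrightarrow> (\<exists>f. iso_map f X Y)"
  by (simp add: graph_iso_def iso_map_def)

lemma simple_graph_edge:
  assumes "simple_graph X" "e \<in> edges X"
  obtains x y where "e = {x, y}" "x \<noteq> y" "x \<in> verts X" "y \<in> verts X"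
proof -
  have "e \<subseteq> verts X" "card e = 2"
    using assms by (auto simp: simple_graph_def)
  then show thesis
    using that by (auto simp: card_2_iff)
qed

lemma simple_graph_edgeD:
  assumes "simple_graph X" "{x, y} \<in> edges X"
  shows "x \<noteq> y" "x \<in> verts X" "y \<in> verts X"
  using assms by (auto simp: simple_graph_def card_insert_if split: if_splits)

lemma simple_graph_edge_eqI:
  assumes "simple_graph X" "f \<in> edges X" "x \<in> f" "y \<in> f" "x \<noteq> y"
  shows "f = {x, y}"
proof -
  obtain p q where "f = {p, q}"
    using simple_graph_edge[OF assms(1,2)] by metis
  then show ?thesis
    using assms by auto
qed

lemma finite_edges: "simple_graph X \<Longrightarrow> finite (edges X)"
  by (rule finite_subset[of _ "Pow (verts X)"]) (auto simp: simple_graph_def)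

lemma nbrs_subset: "simple_graph X \<Longrightarrow> nbrs X x \<subseteq> verts X - {x}"
  by (auto simp: nbrs_def dest: simple_graph_edgeD)

lemma finite_nbrs: "simple_graph X \<Longrightarrow> finite (nbrs X x)"
  using nbrs_subset[of X x] by (auto simp: simple_graph_def dest: finite_subset)

lemma mem_nbrs_commute: "y \<in> nbrs X x \<longleftrightarrow> x \<in> nbrs X y"
  by (simp add: nbrs_def insert_commute)

lemma deg_pos_iff: "simple_graph X \<Longrightarrow> 0 < deg X x \<longleftrightarrow> (\<exists>y. {x, y} \<in> edges X)"
  using finite_nbrs[of X x] by (auto simp: deg_def card_gt_0_iff nbrs_def)

section \<open>Deleting and replacing an edge\<close>

lemma simple_delete_edge: "simple_graph X \<Longrightarrow> simple_graph (delete_edge X e)"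
  by (auto simp: simple_graph_def delete_edge_def)

lemma verts_delete_edge [simp]: "verts (delete_edge X e) = verts X"
  by (simp add: delete_edge_def)

lemma edges_delete_edge [simp]: "edges (delete_edge X e) = edges X - {e}"
  by (simp add: delete_edge_def)

lemma verts_replace_edge [simp]: "verts (replace_edge X e e') = verts X"
  by (simp add: replace_edge_def)

lemma edges_replace_edge [simp]: "edges (replace_edge X e e') = insert e' (edges X - {e})"
  by (simp add: replace_edge_def)

lemma mem_nbrs_replace_edge:
  "z \<in> nbrs (replace_edge X e e') w \<longleftrightarrow> {w, z} = e' \<or> {w, z} \<noteq> e \<and> z \<in> nbrs X w"
  by (auto simp: nbrs_def)

lemma simple_replace_edge:
  "simple_graph X \<Longrightarrow> x \<in> verts X \<Longrightarrow> y \<in> verts X \<Longrightarrow> x \<noteq> y \<Longrightarrow>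
    simple_graph (replace_edge X e {x, y})"
  by (auto simp: simple_graph_def replace_edge_def)

lemma deg_delete_edge:
  assumes "simple_graph X" "e \<in> edges X"
  shows "deg (delete_edge X e) z = deg X z - (if z \<in> e then 1 else 0)"
proof -
  obtain x y where e: "e = {x, y}" "x \<noteq> y"
    using assms simple_graph_edge by metis
  have *: "nbrs (delete_edge X e) z = (if z = x then nbrs X z - {y}
      else if z = y then nbrs X z - {x} else nbrs X z)"
    using e by (auto simp: nbrs_def doubleton_eq_iff)
  have "x \<in> nbrs X y" "y \<in> nbrs X x"
    using assms e by (auto simp: nbrs_def insert_commute)
  then show ?thesis
    using e(2) finite_nbrs[OF assms(1)] unfolding deg_def * by (auto simp: e(1))
qed

lemma deg_replace_edge:
  assumes "simple_graph X" "x \<noteq> y" "{x, y} \<notin> edges X - {e}"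
  shows "deg (replace_edge X e {x, y}) z
    = deg (delete_edge X e) z + (if z \<in> {x, y} then 1 else 0)"
proof -
  have *: "nbrs (replace_edge X e {x, y}) z = (if z = x then insert y (nbrs (delete_edge X e) z)
      else if z = y then insert x (nbrs (delete_edge X e) z) else nbrs (delete_edge X e) z)"
    using assms(2) by (auto simp: nbrs_def doubleton_eq_iff)
  have "x \<notin> nbrs (delete_edge X e) y" "y \<notin> nbrs (delete_edge X e) x"
    using assms by (auto simp: nbrs_def insert_commute)
  moreover have "finite (nbrs (delete_edge X e) w)" for w
    using assms(1) by (simp add: finite_nbrs simple_delete_edge)
  ultimately show ?thesis
    using assms(2) by (auto simp: deg_def *)
qed

text \<open>An adjacent edge contains exactly one of the two ends, so the adjacent edges split into
  the other edges at \<open>x\<close> and the other edges at \<open>y\<close>. The summand 2 avoids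
  truncated subtraction.\<close>

lemma edge_degree_conv_deg:
  assumes "simple_graph X" "{x, y} \<in> edges X"
  shows "edge_degree X {x, y} + 2 = deg X x + deg X y"
proof -
  have xy: "x \<noteq> y"
    using assms by (rule simple_graph_edgeD)
  let ?A = "(\<lambda>z. {x, z}) ` (nbrs X x - {y})" and ?B = "(\<lambda>z. {y, z}) ` (nbrs X y - {x})"
  have "{f \<in> edges X. f \<noteq> {x, y} \<and> f \<inter> {x, y} \<noteq> {}} = ?A \<union> ?B"
  proof (intro equalityI subsetI)
    fix f assume f: "f \<in> {f \<in> edges X. f \<noteq> {x, y} \<and> f \<inter> {x, y} \<noteq> {}}"
    then obtain p q where "f = {p, q}" "p \<noteq> q"
      using simple_graph_edge[OF assms(1)] by (metis (mono_tags, lifting) mem_Collect_eq)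
    with f show "f \<in> ?A \<union> ?B"
      by (auto simp: nbrs_def image_iff doubleton_eq_iff insert_commute)
  qed (use xy in \<open>auto simp: nbrs_def doubleton_eq_iff\<close>)
  moreover have "?A \<inter> ?B = {}"
    using xy by (auto simp: doubleton_eq_iff)
  moreover have "card ?A = deg X x - 1" "card ?B = deg X y - 1"
    using assms finite_nbrs[OF assms(1)]
    by (subst card_image; auto simp: deg_def inj_on_def doubleton_eq_iff nbrs_def insert_commute)+
  moreover have "0 < deg X x" "0 < deg X y"
    using assms by (auto simp: deg_pos_iff insert_commute)
  moreover have "finite ?A" "finite ?B"
    using finite_nbrs[OF assms(1)] by auto
  ultimately show ?thesis
    by (simp add: edge_degree_def card_Un_disjoint)
qed

text \<open>The degree recorded with the new edge is determined by the card itself; this equation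
  restricts the pairs that may be joined.\<close>

lemma edge_degree_replace_edge:
  assumes "simple_graph X" "x \<in> verts X" "y \<in> verts X" "x \<noteq> y" "{x, y} \<notin> edges X - {e}"
  shows "edge_degree (replace_edge X e {x, y}) {x, y}
    = deg (delete_edge X e) x + deg (delete_edge X e) y"
  using edge_degree_conv_deg[OF simple_replace_edge[OF assms(1-4), of e], of x y]
    deg_replace_edge[OF assms(1,4,5)]
  by simp

lemma delete_replace_edge: "e' \<notin> edges X - {e} \<Longrightarrow> delete_edge (replace_edge X e e') e' = delete_edge X e"
  by (auto simp: delete_edge_def replace_edge_def)

section \<open>Transport along isomorphisms\<close>

lemma iso_map_inj_on: "iso_map f X Y \<Longrightarrow> inj_on f (verts X)"
  by (simp add: iso_map_def bij_betw_def)

text \<open>\<open>A\<close> is any set of vertices, because non-adjacency has to be transported as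
  well; the image map is injective on all such sets.\<close>

lemma iso_map_edge_iff:
  assumes "simple_graph X" "iso_map f X Y" "A \<subseteq> verts X"
  shows "f ` A \<in> edges Y \<longleftrightarrow> A \<in> edges X"
proof -
  have "inj_on (image f) (Pow (verts X))"
    using iso_map_inj_on[OF assms(2)] by (simp add: inj_on_image_Pow)
  moreover have "edges X \<subseteq> Pow (verts X)"
    using assms(1) by (auto simp: simple_graph_def)
  ultimately show ?thesis
    using assms by (auto simp: iso_map_def inj_on_def)
qed

lemma iso_map_simple:
  assumes "simple_graph X" "iso_map f X Y"
  shows "simple_graph Y"
proof -
  have "f ` e \<subseteq> verts Y \<and> card (f ` e) = 2" if "e \<in> edges X" for e
  proof -
    have "e \<subseteq> verts X" "card e = 2"
      using assms(1) that by (auto simp: simple_graph_def)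
    then show ?thesis
      using assms(2) by (auto simp: iso_map_def bij_betw_def card_image inj_on_subset)
  qed
  moreover have "finite (verts Y)"
    using assms by (auto simp: iso_map_def simple_graph_def dest: bij_betw_finite)
  ultimately show ?thesis
    using assms(2) by (auto simp: simple_graph_def iso_map_def)
qed

lemma iso_map_nbrs:
  assumes "simple_graph X" "iso_map f X Y" "x \<in> verts X"
  shows "nbrs Y (f x) = f ` nbrs X x"
proof (intro equalityI subsetI)
  fix y assume y: "y \<in> nbrs Y (f x)"
  have "y \<in> verts Y"
    using nbrs_subset[OF iso_map_simple[OF assms(1,2)]] y by blast
  then obtain z where z: "z \<in> verts X" "y = f z"
    using assms(2) unfolding iso_map_def bij_betw_def by blast
  with y iso_map_edge_iff[OF assms(1,2), of "{x, z}"] assms(3) show "y \<in> f ` nbrs X x"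
    by (auto simp: nbrs_def)
next
  fix y assume "y \<in> f ` nbrs X x"
  then obtain z where "y = f z" "{x, z} \<in> edges X"
    by (auto simp: nbrs_def)
  moreover from this(2) have "f ` {x, z} \<in> edges Y"
    using assms(2) unfolding iso_map_def by blast
  ultimately show "y \<in> nbrs Y (f x)"
    by (simp add: nbrs_def)
qed

lemma iso_map_deg:
  assumes "simple_graph X" "iso_map f X Y" "x \<in> verts X"
  shows "deg Y (f x) = deg X x"
  unfolding deg_def iso_map_nbrs[OF assms]
  using nbrs_subset[OF assms(1)]
  by (intro card_image inj_on_subset[OF iso_map_inj_on[OF assms(2)]]) blast

lemma iso_map_edge_degree:
  assumes "simple_graph X" "iso_map f X Y" "e \<in> edges X"
  shows "edge_degree Y (f ` e) = edge_degree X e"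
proof -
  obtain x y where e: "e = {x, y}" "x \<in> verts X" "y \<in> verts X"
    using simple_graph_edge[OF assms(1,3)] by metis
  have "f ` e \<in> edges Y"
    using assms by (auto simp: iso_map_def)
  then show ?thesis
    using edge_degree_conv_deg[OF assms(1), of x y] assms e
      edge_degree_conv_deg[OF iso_map_simple[OF assms(1,2)], of "f x" "f y"]
    by (simp add: iso_map_deg)
qed

lemma iso_map_delete_edge:
  assumes "simple_graph X" "iso_map f X Y" "e \<in> edges X"
  shows "iso_map f (delete_edge X e) (delete_edge Y (f ` e))"
proof -
  have "f ` e' = f ` e \<Longrightarrow> e' = e" if "e' \<in> edges X" for e'
    using that assms iso_map_inj_on[OF assms(2)]
    by (auto simp: simple_graph_def inj_on_image_eq_iff)
  then show ?thesis
    using assms by (auto simp: iso_map_def)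
qed

lemma iso_map_inv:
  assumes "simple_graph X" "iso_map f X Y"
  shows "iso_map (inv_into (verts X) f) Y X"
proof -
  have b: "bij_betw f (verts X) (verts Y)" and eY: "edges Y = (\<lambda>e. f ` e) ` edges X"
    using assms by (auto simp: iso_map_def)
  have "inv_into (verts X) f ` f ` e = e" if "e \<in> edges X" for e
    using that assms(1) b by (intro inv_into_image_cancel) (auto simp: simple_graph_def bij_betw_def)
  then have "(\<lambda>e. inv_into (verts X) f ` e) ` edges Y = edges X"
    unfolding eY by (force simp: image_image)
  then show ?thesis
    using b by (simp add: iso_map_def bij_betw_inv_into)
qed

text \<open>Only one inclusion of the edge sets needs checking, as each edge is the image of its own
  image.\<close>

lemma iso_map_involution:
  assumes X: "simple_graph X" and v: "\<And>z. z \<in> verts X \<Longrightarrow> \<tau> z \<in> verts X"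
    and inv: "\<And>z. z \<in> verts X \<Longrightarrow> \<tau> (\<tau> z) = z"
    and move: "\<And>x y. {x, y} \<in> edges X \<Longrightarrow> {\<tau> x, \<tau> y} \<in> edges X"
  shows "iso_map \<tau> X X"
proof -
  have im: "\<tau> ` e \<in> edges X \<and> \<tau> ` \<tau> ` e = e" if e: "e \<in> edges X" for e
  proof -
    obtain x y where "e = {x, y}" "x \<in> verts X" "y \<in> verts X"
      using simple_graph_edge[OF X e] by metis
    then show ?thesis
      using move[of x y] e inv by simp
  qed
  then have "edges X \<subseteq> (\<lambda>e. \<tau> ` e) ` edges X"
    by (metis image_eqI subsetI)
  moreover have "(\<lambda>e. \<tau> ` e) ` edges X \<subseteq> edges X"
    using im by blast
  moreover have "bij_betw \<tau> (verts X) (verts X)"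
    by (rule bij_betw_byWitness[where f' = \<tau>]) (use v inv in auto)
  ultimately show ?thesis
    unfolding iso_map_def by blast
qed

lemma iso_map_comp: "iso_map f X Y \<Longrightarrow> iso_map g Y Z \<Longrightarrow> iso_map (g \<circ> f) X Z"
  by (auto simp: iso_map_def image_image image_comp bij_betw_trans[of f _ _ g])

lemma graph_iso_refl: "graph_iso X X"
  unfolding graph_iso_def by (rule exI[of _ id]) auto

lemma graph_iso_sym: "simple_graph X \<Longrightarrow> graph_iso X Y \<Longrightarrow> graph_iso Y X"
  using iso_map_inv by (auto simp: graph_iso_iff_iso_map)

lemma graph_iso_trans: "graph_iso X Y \<Longrightarrow> graph_iso Y Z \<Longrightarrow> graph_iso X Z"
  unfolding graph_iso_iff_iso_map using iso_map_comp by metis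

lemma iso_map_replace_edge:
  assumes "simple_graph X" "iso_map f X Y" "e \<in> edges X"
  shows "iso_map f (replace_edge X e e') (replace_edge Y (f ` e) (f ` e'))"
  using iso_map_delete_edge[OF assms] by (auto simp: iso_map_def)

lemma ex_nat_copy:
  assumes "simple_graph X"
  shows "\<exists>Y :: nat ugraph. simple_graph Y \<and> graph_iso X Y"
proof -
  obtain f :: "_ \<Rightarrow> nat" where f: "inj_on f (verts X)"
    using assms finite_imp_inj_to_nat_seg by (metis simple_graph_def)
  let ?Y = "\<lparr>verts = f ` verts X, edges = (\<lambda>e. f ` e) ` edges X\<rparr>"
  have "iso_map f X ?Y"
    using f by (auto simp: iso_map_def bij_betw_def)
  then show ?thesis
    using assms iso_map_simple by (auto simp: graph_iso_iff_iso_map)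
qed

section \<open>Equality of cards and reconstruction from a card\<close>

lemma unlabeled_eq_iff:
  assumes "simple_graph X" "simple_graph Y"
  shows "unlabeled X = unlabeled Y \<longleftrightarrow> graph_iso X Y"
proof
  assume "unlabeled X = unlabeled Y"
  \<comment> \<open>Equality of the classes says something only because they are not empty: a copy
    on \<open>nat\<close> is a common member.\<close>
  moreover obtain Z :: "nat ugraph" where "simple_graph Z" "graph_iso X Z"
    using ex_nat_copy[OF assms(1)] by auto
  ultimately have "graph_iso Y Z"
    by (auto simp: unlabeled_def)
  then show "graph_iso X Y"
    using \<open>graph_iso X Z\<close> assms(2) by (meson graph_iso_sym graph_iso_trans)
next
  assume "graph_iso X Y"
  then show "unlabeled X = unlabeled Y"
    using assms by (auto simp: unlabeled_def intro: graph_iso_trans graph_iso_sym)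
qed

lemma da_ecard_eq_iff:
  assumes "simple_graph X" "simple_graph Y"
  shows "da_ecard X e = da_ecard Y f \<longleftrightarrow>
    edge_degree X e = edge_degree Y f \<and> graph_iso (delete_edge X e) (delete_edge Y f)"
  using assms by (simp add: da_ecard_def unlabeled_eq_iff simple_delete_edge)

lemma iso_map_da_ecard:
  assumes "simple_graph X" "iso_map f X Y" "e \<in> edges X"
  shows "da_ecard Y (f ` e) = da_ecard X e"
proof -
  have "graph_iso (delete_edge X e) (delete_edge Y (f ` e))"
    using iso_map_delete_edge[OF assms] by (auto simp: graph_iso_iff_iso_map)
  then show ?thesis
    using da_ecard_eq_iff[OF assms(1) iso_map_simple[OF assms(1,2)]] iso_map_edge_degree[OF assms]
    by metis
qed

lemma iso_map_da_edeck:
  assumes "simple_graph X" "iso_map f X Y"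
  shows "da_edeck Y = da_edeck X"
proof -
  have "edges X \<subseteq> Pow (verts X)"
    using assms(1) by (auto simp: simple_graph_def)
  then have "inj_on (image f) (edges X)"
    using inj_on_image_Pow[OF iso_map_inj_on[OF assms(2)]] inj_on_subset by metis
  then have "mset_set (edges Y) = image_mset (image f) (mset_set (edges X))"
    using assms(2) by (simp add: iso_map_def image_mset_mset_set)
  then show ?thesis
    using finite_edges[OF assms(1)] iso_map_da_ecard[OF assms]
    by (auto simp: da_edeck_def multiset.map_comp intro!: image_mset_cong)
qed

lemma da_ecard_replace_edge:
  assumes "simple_graph X" "e \<in> edges X" "x \<in> verts X" "y \<in> verts X" "x \<noteq> y"
    and "{x, y} \<notin> edges X - {e}"
    and "deg (delete_edge X e) x + deg (delete_edge X e) y = edge_degree X e"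
  shows "da_ecard (replace_edge X e {x, y}) {x, y} = da_ecard X e"
  using assms by (simp add: da_ecard_def edge_degree_replace_edge delete_replace_edge)

text \<open>An isomorphism of the cards carries the deleted edge of \<open>Y\<close> to a pair not
  joined in the card of \<open>X\<close>, and joining this pair rebuilds \<open>Y\<close>. The pair
  may be \<open>e\<close> itself, so only the edges other than \<open>e\<close> are
  excluded.\<close>

lemma da_ecard_eq_imp_iso_replace_edge:
  assumes X: "simple_graph X" and Y: "simple_graph Y" and e: "e \<in> edges X" and f: "f \<in> edges Y"
    and eq: "da_ecard X e = da_ecard Y f"
  obtains x y where "x \<in> verts X" "y \<in> verts X" "x \<noteq> y" "{x, y} \<notin> edges X - {e}"
    "deg (delete_edge X e) x + deg (delete_edge X e) y = edge_degree X e"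
    "graph_iso Y (replace_edge X e {x, y})"
proof -
  obtain p q where f_eq: "f = {p, q}" and pq: "p \<noteq> q" "p \<in> verts Y" "q \<in> verts Y"
    using simple_graph_edge[OF Y f] by metis
  have "graph_iso (delete_edge Y f) (delete_edge X e)"
    using eq X Y by (metis da_ecard_eq_iff)
  then obtain \<phi> where \<phi>: "iso_map \<phi> (delete_edge Y f) (delete_edge X e)"
    by (auto simp: graph_iso_iff_iso_map)
  have inj: "inj_on \<phi> (verts Y)" and im: "\<phi> ` verts Y = verts X"
    using \<phi> by (auto simp: iso_map_def bij_betw_def)
  have sY: "simple_graph (delete_edge Y f)"
    using Y by (rule simple_delete_edge)
  show thesis
  proof
    show "\<phi> p \<in> verts X" "\<phi> q \<in> verts X" "\<phi> p \<noteq> \<phi> q"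
      using pq inj im by (auto simp: inj_on_def)
    show "{\<phi> p, \<phi> q} \<notin> edges X - {e}"
      using iso_map_edge_iff[OF sY \<phi>, of f] pq by (simp add: f_eq)
    have "deg (delete_edge X e) (\<phi> p) = deg (delete_edge Y f) p"
      "deg (delete_edge X e) (\<phi> q) = deg (delete_edge Y f) q"
      using pq by (auto intro!: iso_map_deg[OF sY \<phi>])
    moreover have "deg (delete_edge Y f) p + deg (delete_edge Y f) q = edge_degree Y f"
      using edge_degree_replace_edge[OF Y pq(2,3,1), of f] f f_eq
      by (simp add: replace_edge_def insert_absorb)
    ultimately show "deg (delete_edge X e) (\<phi> p) + deg (delete_edge X e) (\<phi> q) = edge_degree X e"
      using eq by (simp add: da_ecard_def)
    have "edges X - {e} = (\<lambda>e. \<phi> ` e) ` (edges Y - {f})"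
      using \<phi> by (simp add: iso_map_def)
    moreover have "{\<phi> p, \<phi> q} = \<phi> ` f"
      by (simp add: f_eq)
    ultimately have "edges (replace_edge X e {\<phi> p, \<phi> q})
        = (\<lambda>e. \<phi> ` e) ` insert f (edges Y - {f})"
      by (simp only: edges_replace_edge image_insert)
    also have "insert f (edges Y - {f}) = edges Y"
      using f by blast
    finally have "iso_map \<phi> Y (replace_edge X e {\<phi> p, \<phi> q})"
      using \<phi> by (auto simp: iso_map_def)
    then show "graph_iso Y (replace_edge X e {\<phi> p, \<phi> q})"
      unfolding graph_iso_iff_iso_map by blast
  qed
qed

section \<open>Decks, overlap and \<open>adern\<close>\<close>

lemma set_da_edeck: "simple_graph X \<Longrightarrow> set_mset (da_edeck X) = da_ecard X ` edges X"
  by (simp add: da_edeck_def finite_edges)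

lemma size_da_edeck: "size (da_edeck X) = card (edges X)"
  by (simp add: da_edeck_def)

lemma overlap_commute: "overlap X Y = overlap Y X"
  by (simp add: overlap_def subset_mset.inf.commute)

lemma overlap_graph_iso:
  assumes "simple_graph Y" "graph_iso Y Z"
  shows "overlap X Y = overlap X Z"
  using assms iso_map_da_edeck unfolding graph_iso_iff_iso_map overlap_def by metis

text \<open>Edges of \<open>Y\<close> are counted instead of cards; distinct edges may have the same
  card, hence only an upper bound. By symmetry of the overlap either graph can play the part of
  \<open>Y\<close>.\<close>

lemma overlap_le_card:
  assumes X: "simple_graph X" and Y: "simple_graph Y"
    and S: "{f \<in> edges Y. da_ecard Y f \<in> da_ecard X ` edges X} \<subseteq> S" "finite S"
  shows "overlap X Y \<le> card S"
proof -
  let ?P = "\<lambda>c. c \<in># da_edeck X"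
  have "da_edeck X \<inter># da_edeck Y \<subseteq># filter_mset ?P (da_edeck Y)"
    by (rule mset_subset_eqI) (simp add: not_in_iff)
  then have "overlap X Y \<le> size (filter_mset ?P (da_edeck Y))"
    unfolding overlap_def by (rule size_mset_mono)
  also have "\<dots> = card {f \<in> edges Y. da_ecard Y f \<in># da_edeck X}"
    using finite_edges[OF Y] by (simp add: da_edeck_def filter_mset_image_mset)
  also have "\<dots> \<le> card S"
    using S by (intro card_mono) (auto simp: set_da_edeck[OF X])
  finally show ?thesis .
qed

text \<open>A common family of \<open>Suc K\<close> cards would not fit into an intersection of size
  at most \<open>K\<close>, while each \<open>k \<le> K\<close> is defeated by a part of what is
  shared with \<open>Y\<close>. The last hypothesis guarantees that families of \<open>Suc K\<close>
  cards exist, as \<open>adern\<close> demands.\<close>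

lemma adern_eqI:
  fixes X :: "'a ugraph" and Y :: "'b ugraph"
  assumes X: "simple_graph X" and Y: "simple_graph Y" "\<not> graph_iso X Y" "K \<le> overlap X Y"
    and le: "\<And>H :: nat ugraph. simple_graph H \<Longrightarrow> \<not> graph_iso X H \<Longrightarrow> overlap X H \<le> K"
    and card: "K < card (edges X)"
  shows "adern X = enat (Suc K)"
proof -
  obtain Z :: "nat ugraph" where Z: "simple_graph Z" "graph_iso Y Z"
    using ex_nat_copy[OF Y(1)] by auto
  have nZ: "\<not> graph_iso X Z"
    using Y Z graph_iso_trans graph_iso_sym by metis
  have KZ: "K \<le> overlap X Z"
    using Y Z overlap_graph_iso by metis
  define Good where "Good = {k. k \<le> size (da_edeck X) \<and>
     (\<forall>C. C \<subseteq># da_edeck X \<and> size C = k \<longrightarrow>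
        \<not> (\<exists>H :: nat ugraph. simple_graph H \<and> \<not> graph_iso X H \<and> C \<subseteq># da_edeck H))}"
  have "Suc K \<in> Good"
  proof -
    have False if "C \<subseteq># da_edeck X" "size C = Suc K" "simple_graph H" "\<not> graph_iso X H"
      "C \<subseteq># da_edeck H" for C and H :: "nat ugraph"
    proof -
      have "C \<subseteq># da_edeck X \<inter># da_edeck H"
        using that by simp
      then have "size C \<le> overlap X H"
        unfolding overlap_def by (rule size_mset_mono)
      then show False
        using le[of H] that by simp
    qed
    then show ?thesis
      using card by (auto simp: Good_def size_da_edeck)
  qed
  moreover have "Suc K \<le> k" if "k \<in> Good" for k
  proof (rule ccontr)
    assume "\<not> Suc K \<le> k"
    then have "k \<le> size (da_edeck X \<inter># da_edeck Z)"
      using KZ by (simp add: overlap_def)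
    then obtain C where "C \<subseteq># da_edeck X \<inter># da_edeck Z" "size C = k"
      by (metis ex_mset mset_subset_eq_exists_conv size_mset append_take_drop_id
          length_take min.absorb2 mset_append mset_subset_eq_add_left)
    then show False
      using that Z nZ by (auto simp: Good_def)
  qed
  ultimately have "Inf (enat ` Good) = enat (Suc K)"
    by (intro antisym Inf_greatest Inf_lower) auto
  then show ?thesis
    by (simp add: adern_def Good_def)
qed

text \<open>For \<open>K = 0\<close> any non-isomorphic graph serves as witness; the empty graph is
  one.\<close>

lemma adern_eq_1I:
  fixes X :: "'a ugraph"
  assumes le: "\<And>H :: nat ugraph. simple_graph H \<Longrightarrow> \<not> graph_iso X H \<Longrightarrow> overlap X H = 0"
    and X: "simple_graph X" and ne: "edges X \<noteq> {}"
  shows "adern X = 1"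
proof -
  define Y :: "nat ugraph" where "Y = \<lparr>verts = {}, edges = {}\<rparr>"
  have "simple_graph Y" "\<not> graph_iso X Y"
    using ne by (auto simp: Y_def simple_graph_def graph_iso_def)
  moreover have "0 < card (edges X)"
    using ne finite_edges[OF X] by (simp add: card_gt_0_iff)
  ultimately show ?thesis
    using adern_eqI[OF X, of Y 0] le by (simp add: one_enat_def)
qed

section \<open>Links between vertices of large degree\<close>

definition leaves :: "'a ugraph \<Rightarrow> 'a \<Rightarrow> 'a set" where
  "leaves X h = {y \<in> nbrs X h. deg X y = 1}"

text \<open>A walk between vertices of degree at least 3, with inner vertices of smaller degree and
  no immediate return. Without the last condition a hub, one of its leaves and the hub again would
  form a link. The ends may coincide, so a cycle through one hub counts as well.\<close>

definition link :: "'a ugraph \<Rightarrow> (nat \<Rightarrow> 'a) \<Rightarrow> nat \<Rightarrow> bool" where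
  "link X c r \<longleftrightarrow> 0 < r \<and> 3 \<le> deg X (c 0) \<and> 3 \<le> deg X (c r) \<and>
     (\<forall>i<r. {c i, c (Suc i)} \<in> edges X) \<and> (\<forall>i. 0 < i \<and> i < r \<longrightarrow> deg X (c i) \<le> 2) \<and>
     (\<forall>i. Suc (Suc i) \<le> r \<longrightarrow> c (Suc (Suc i)) \<noteq> c i)"

text \<open>The properties by which a card of a non-pendant edge of a broom is recognised.\<close>

definition broomlike :: "nat \<Rightarrow> nat \<Rightarrow> 'a ugraph \<Rightarrow> bool" where
  "broomlike n k X \<longleftrightarrow> (\<forall>h. 3 \<le> deg X h \<longrightarrow> n \<le> card (leaves X h)) \<and>
     (\<forall>c r. link X c r \<longrightarrow> r = k - 1 \<and> c 0 \<noteq> c r)"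

lemma deg_pos_imp_verts: "simple_graph X \<Longrightarrow> 0 < deg X x \<Longrightarrow> x \<in> verts X"
  by (auto simp: deg_pos_iff dest: simple_graph_edgeD)

lemma finite_leaves: "simple_graph X \<Longrightarrow> finite (leaves X h)"
  by (simp add: leaves_def finite_nbrs)

lemma iso_map_link:
  assumes X: "simple_graph X" and f: "iso_map f X Y" and l: "link X c r"
  shows "link Y (f \<circ> c) r"
proof -
  have e: "{c i, c (Suc i)} \<in> edges X" if "i < r" for i
    using l that by (simp add: link_def)
  have v: "c i \<in> verts X" if "i \<le> r" for i
  proof (cases "i < r")
    case True
    then show ?thesis
      using e X by (meson simple_graph_edgeD(2))
  next
    case False
    then have "i = Suc (r - 1)" "r - 1 < r"
      using that l by (auto simp: link_def)
    then show ?thesis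
      using e[of "r - 1"] X by (metis simple_graph_edgeD(3))
  qed
  have d: "deg Y (f (c i)) = deg X (c i)" if "i \<le> r" for i
    using iso_map_deg[OF X f] v that by simp
  have "{f (c i), f (c (Suc i))} \<in> edges Y" if "i < r" for i
    using iso_map_edge_iff[OF X f, of "{c i, c (Suc i)}"] e v that by simp
  moreover have "f (c (Suc (Suc i))) \<noteq> f (c i)" if "Suc (Suc i) \<le> r" for i
    using l v that inj_onD[OF iso_map_inj_on[OF f]]
    unfolding link_def by (metis Suc_leD)
  ultimately show ?thesis
    using l d by (simp add: link_def)
qed

lemma iso_map_leaves:
  assumes X: "simple_graph X" and f: "iso_map f X Y" and h: "h \<in> verts X"
  shows "leaves Y (f h) = f ` leaves X h"
proof -
  have "deg Y (f y) = deg X y" if "y \<in> nbrs X h" for y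
    using that nbrs_subset[OF X] by (intro iso_map_deg[OF X f]) blast
  then show ?thesis
    unfolding leaves_def iso_map_nbrs[OF X f h] by auto
qed

lemma iso_map_broomlike:
  assumes X: "simple_graph X" and f: "iso_map f X Y" and Y: "broomlike n k Y"
  shows "broomlike n k X"
  unfolding broomlike_def
proof (intro conjI allI impI)
  fix h assume "3 \<le> deg X h"
  then have h: "h \<in> verts X"
    using deg_pos_imp_verts[OF X, of h] by simp
  have "leaves X h \<subseteq> verts X"
    using nbrs_subset[OF X] by (auto simp: leaves_def)
  then have "inj_on f (leaves X h)"
    using iso_map_inj_on[OF f] inj_on_subset by blast
  then have "card (leaves Y (f h)) = card (leaves X h)"
    unfolding iso_map_leaves[OF X f h] by (rule card_image)
  then show "n \<le> card (leaves X h)"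
    using Y iso_map_deg[OF X f h] \<open>3 \<le> deg X h\<close> unfolding broomlike_def by metis
next
  fix c r assume "link X c r"
  then have "link Y (f \<circ> c) r"
    by (rule iso_map_link[OF X f])
  then have "r = k - 1 \<and> f (c 0) \<noteq> f (c r)"
    using Y unfolding broomlike_def comp_def by blast
  then show "r = k - 1" "c 0 \<noteq> c r"
    by auto
qed

text \<open>The edge $f$ must lie on the link, which does not occur in a card, and its deletion must turn a
  neighbour of the last vertex of the link into a leaf.\<close>

lemma broomlike_delete_edge_on_link:
  assumes X: "simple_graph X" and f: "f \<in> edges X" and bl: "broomlike n k (delete_edge X f)"
    and ends: "4 \<le> deg X (c 0)" "4 \<le> deg X (c r)" and r: "2 \<le> r"
    and adj: "\<And>i. i < r \<Longrightarrow> {c i, c (Suc i)} \<in> edges X"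
    and inner: "\<And>i. 0 < i \<Longrightarrow> i < r \<Longrightarrow> deg X (c i) = 2"
    and inj: "inj_on c {0..<r}" and ner: "\<And>i. 0 < i \<Longrightarrow> i < r \<Longrightarrow> c i \<noteq> c r"
    and closed: "c 0 = c r \<Longrightarrow> 3 \<le> r" and len: "c 0 = c r \<or> r \<noteq> k - 1"
    and few: "card (leaves X (c r)) < n"
  shows "f = {c (r - 2), c (r - 1)} \<or> c 0 = c r \<and> f = {c 1, c 2}"
proof -
  let ?D = "delete_edge X f"
  have ne: "c i \<noteq> c j" if "i < r" "j < r" "i \<noteq> j" for i j
    using inj that by (auto simp: inj_on_def)
  have degD: "deg ?D z = deg X z - (if z \<in> f then 1 else 0)" for z
    by (rule deg_delete_edge[OF X f])
  \<comment> \<open>A closed link repeats its starting vertex at \<open>r\<close>, so injectivity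
    stops before \<open>r\<close>; the assumption \<open>closed\<close> rules out a return of length
    2.\<close>
  have nb: "c (Suc (Suc i)) \<noteq> c i" if "Suc (Suc i) \<le> r" for i
  proof (cases "Suc (Suc i) < r")
    case True
    then show ?thesis by (simp add: ne)
  next
    case False
    then have "r = Suc (Suc i)"
      using that by simp
    then show ?thesis
      using ner[of i] closed by (cases "i = 0") auto
  qed
  \<comment> \<open>Ends of degree at least 4 keep degree at least 3 in the card, so a link
    untouched by \<open>f\<close> would survive there, closed or of the wrong length.\<close>
  have "\<exists>t<r. f = {c t, c (Suc t)}"
  proof (rule ccontr)
    assume "\<not> ?thesis"
    then have "{c i, c (Suc i)} \<in> edges ?D" if "i < r" for i
      using adj[OF that] that by auto
    moreover have "deg ?D (c i) \<le> 2" if "0 < i" "i < r" for i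
      using degD inner that by simp
    ultimately have "link ?D c r"
      using ends degD r nb by (auto simp: link_def)
    then show False
      using bl len by (auto simp: broomlike_def)
  qed
  then obtain t where t: "t < r" "f = {c t, c (Suc t)}"
    by blast
  have "3 \<le> deg ?D (c 0)" "3 \<le> deg ?D (c r)"
    using degD ends by auto
  then have "n \<le> card (leaves ?D (c r))"
    using bl by (simp add: broomlike_def)
  \<comment> \<open>The card has \<open>n\<close> leaves at \<open>c r\<close> and \<open>X\<close>
    has fewer, so some neighbour \<open>y\<close> of \<open>c r\<close> became a leaf by losing
    \<open>f\<close>, and \<open>f\<close> is not the edge from \<open>y\<close> to
    \<open>c r\<close>.\<close>
  then have "\<not> leaves ?D (c r) \<subseteq> leaves X (c r)"
    using few card_mono[OF finite_leaves[OF X]] by (metis leD le_less_trans)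
  then obtain y where y: "y \<in> nbrs ?D (c r)" "deg ?D y = 1" "y \<notin> leaves X (c r)"
    by (auto simp: leaves_def)
  then have yX: "y \<in> nbrs X (c r)" and f_ne: "f \<noteq> {c r, y}"
    by (auto simp: nbrs_def)
  have "deg X y \<noteq> 1"
    using y yX by (simp add: leaves_def)
  then have "y \<in> f"
    using y(2) degD[of y] by (auto split: if_splits)
  then obtain s where s: "y = c s" "s = t \<or> s = Suc t"
    using t by auto
  have "c s \<noteq> c 0" "c s \<noteq> c r"
    using s(1) y(2) \<open>3 \<le> deg ?D (c 0)\<close> \<open>3 \<le> deg ?D (c r)\<close> by auto
  then have "s \<noteq> 0" "s \<noteq> r"
    by metis+
  then have s_lim: "0 < s" "s < r"
    using s t by auto
  then obtain s' where s': "s = Suc s'"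
    using gr0_implies_Suc by blast
  have "{c s', c (Suc s)} \<subseteq> nbrs X (c s)"
    using adj[of s'] adj[of s] s_lim s' by (simp add: nbrs_def insert_commute)
  moreover have "c s' \<noteq> c (Suc s)"
    using nb[of s'] s_lim s' by auto
  ultimately have "nbrs X (c s) = {c s', c (Suc s)}"
    using inner[OF s_lim] finite_nbrs[OF X]
    by (intro card_seteq[symmetric]) (auto simp: deg_def)
  \<comment> \<open>Both neighbours of \<open>c s\<close> lie on the link, so \<open>c s\<close> is
    next to one of its ends. As the edge to \<open>c r\<close> is not \<open>f\<close>, the other
    edge at \<open>c s\<close> is.\<close>
  moreover have "c r \<in> nbrs X (c s)"
    using yX s by (simp add: mem_nbrs_commute)
  ultimately consider "c r = c s'" | "c r = c (Suc s)"
    by auto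
  then show ?thesis
  proof cases
    case 1
    then have "s' = 0"
      using ner[of s'] s_lim s' by auto
    with 1 s' s t f_ne show ?thesis
      by (auto simp: numeral_2_eq_2)
  next
    case 2
    then have "Suc s = r"
      using ner[of "Suc s"] s_lim by (cases "Suc s < r") auto
    with s t f_ne s_lim show ?thesis
      by (auto simp: insert_commute numeral_2_eq_2)
  qed
qed

section \<open>Brooms\<close>

text \<open>The edges in one orientation, from hub to leaf and from \<open>HubU\<close> towards
  \<open>HubV\<close>. Matching on constructors lets simplification decide adjacency without the
  case distinctions hidden in \<open>path_vertex\<close>.\<close>

fun arc :: "nat \<Rightarrow> nat \<Rightarrow> nat \<Rightarrow> broom_vertex \<Rightarrow> broom_vertex \<Rightarrow> bool" where
  "arc n m k HubU (Inner i j) \<longleftrightarrow> i < m \<and> j = 1"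
| "arc n m k HubU (LeafU a) \<longleftrightarrow> a < n"
| "arc n m k HubV (LeafV a) \<longleftrightarrow> a < n"
| "arc n m k (Inner i j) (Inner i' j') \<longleftrightarrow> i' = i \<and> i < m \<and> 0 < j \<and> j' = Suc j \<and> Suc j' < k"
| "arc n m k (Inner i j) HubV \<longleftrightarrow> i < m \<and> 0 < j \<and> Suc (Suc j) = k"
| "arc n m k _ _ \<longleftrightarrow> False"

lemma arcE:
  assumes "arc n m k x y"
  obtains (start) i where "x = HubU" "y = Inner i 1" "i < m"
    | (leafU) a where "x = HubU" "y = LeafU a" "a < n"
    | (leafV) a where "x = HubV" "y = LeafV a" "a < n"
    | (path) i j where "x = Inner i j" "y = Inner i (Suc j)" "i < m" "0 < j" "Suc (Suc j) < k"
    | (stop) i j where "x = Inner i j" "y = HubV" "i < m" "0 < j" "Suc (Suc j) = k"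
  using assms by (cases x; cases y) auto

text \<open>The reflection exchanging the hubs. It halves the case analyses and also yields a second
  pendant edge with the same card.\<close>

fun mirror :: "nat \<Rightarrow> broom_vertex \<Rightarrow> broom_vertex" where
  "mirror k HubU = HubV"
| "mirror k HubV = HubU"
| "mirror k (Inner i j) = Inner i (k - 1 - j)"
| "mirror k (LeafU a) = LeafV a"
| "mirror k (LeafV a) = LeafU a"

locale broom =
  fixes n m k :: nat
  assumes n_pos: "1 \<le> n" and m_ge: "3 \<le> m" and k_ge: "3 \<le> k"
begin

abbreviation G :: "broom_vertex ugraph" where
  "G \<equiv> strong_double_broom n n m k"

lemma edges_G_conv_arc: "edges G = {{x, y} |x y. arc n m k x y}"
proof (intro equalityI subsetI)
  fix e assume "e \<in> edges G"
  then consider i j where "e = {path_vertex k i j, path_vertex k i (Suc j)}" "i < m" "Suc j < k"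
    | a where "e = {HubU, LeafU a}" "a < n" | a where "e = {HubV, LeafV a}" "a < n"
    by (auto simp: strong_double_broom_def)
  then show "e \<in> {{x, y} |x y. arc n m k x y}"
  proof cases
    case (1 i j)
    then have "arc n m k (path_vertex k i j) (path_vertex k i (Suc j))"
      using k_ge by (auto simp: path_vertex_def)
    then show ?thesis
      using 1 by blast
  next
    case (2 a)
    then have "arc n m k HubU (LeafU a)" by simp
    then show ?thesis using 2 by blast
  next
    case (3 a)
    then have "arc n m k HubV (LeafV a)" by simp
    then show ?thesis using 3 by blast
  qed
next
  fix e assume "e \<in> {{x, y} |x y. arc n m k x y}"
  then obtain x y where e: "e = {x, y}" "arc n m k x y"
    by blast
  have path_edge: "{path_vertex k i j, path_vertex k i (Suc j)} \<in> edges G" if "i < m" "Suc j < k" for i j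
    using that by (auto simp: strong_double_broom_def)
  show "e \<in> edges G"
    using e(2)
  proof (cases rule: arcE)
    case (start i)
    then show ?thesis
      using path_edge[of i 0] k_ge e by (auto simp: path_vertex_def split: if_splits)
  next
    case (path i j)
    then show ?thesis
      using path_edge[of i j] e by (auto simp: path_vertex_def split: if_splits)
  next
    case (stop i j)
    then show ?thesis
      using path_edge[of i j] e by (auto simp: path_vertex_def)
  qed (auto simp: strong_double_broom_def e)
qed

lemma edge_iff: "{x, y} \<in> edges G \<longleftrightarrow> arc n m k x y \<or> arc n m k y x"
  by (auto simp: edges_G_conv_arc doubleton_eq_iff)

lemma mem_verts_G [simp]:
  "HubU \<in> verts G" "HubV \<in> verts G"
  "Inner i j \<in> verts G \<longleftrightarrow> i < m \<and> 0 < j \<and> Suc j < k"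
  "LeafU a \<in> verts G \<longleftrightarrow> a < n" "LeafV a \<in> verts G \<longleftrightarrow> a < n"
proof -
  have "path_vertex k 0 0 = HubU" "path_vertex k 0 (k - 1) = HubV"
    using k_ge by (auto simp: path_vertex_def)
  then show "HubU \<in> verts G" "HubV \<in> verts G"
    using m_ge k_ge unfolding strong_double_broom_def
    by (force intro: exI[of _ 0] exI[of _ "k - 1"])+
  have "Inner i j = path_vertex k i j \<and> i < m \<and> j < k" if "i < m" "0 < j" "Suc j < k"
    using that by (auto simp: path_vertex_def)
  then have "Inner i j \<in> verts G" if "i < m" "0 < j" "Suc j < k"
    using that unfolding strong_double_broom_def ugraph.simps by blast
  moreover have "i < m \<and> 0 < j \<and> Suc j < k" if "Inner i j \<in> verts G"
    using that by (auto simp: strong_double_broom_def path_vertex_def split: if_splits)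
  ultimately show "Inner i j \<in> verts G \<longleftrightarrow> i < m \<and> 0 < j \<and> Suc j < k"
    by blast
qed (auto simp: strong_double_broom_def path_vertex_def split: if_splits)

lemma simple_G: "simple_graph G"
proof -
  have "verts G = (\<lambda>(i, j). path_vertex k i j) ` ({..<m} \<times> {..<k}) \<union> LeafU ` {..<n} \<union> LeafV ` {..<n}"
    by (auto simp: strong_double_broom_def)
  then have "finite (verts G)"
    by simp
  moreover have "{x, y} \<subseteq> verts G \<and> card {x, y} = 2" if "arc n m k x y" for x y
    using that k_ge by (cases rule: arcE) auto
  ultimately show ?thesis
    by (auto simp: simple_graph_def edges_G_conv_arc)
qed

lemma nbrs_G:
  "nbrs G HubU = (\<lambda>i. Inner i 1) ` {..<m} \<union> LeafU ` {..<n}"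
  "nbrs G HubV = (\<lambda>i. Inner i (k - 2)) ` {..<m} \<union> LeafV ` {..<n}"
  "i < m \<Longrightarrow> 0 < j \<Longrightarrow> Suc j < k \<Longrightarrow>
    nbrs G (Inner i j) = {path_vertex k i (j - 1), path_vertex k i (Suc j)}"
  "a < n \<Longrightarrow> nbrs G (LeafU a) = {HubU}"
  "a < n \<Longrightarrow> nbrs G (LeafV a) = {HubV}"
proof -
  have A: "y \<in> nbrs G x \<longleftrightarrow> arc n m k x y \<or> arc n m k y x" for x y
    by (simp add: nbrs_def edge_iff)
  show "nbrs G HubU = (\<lambda>i. Inner i 1) ` {..<m} \<union> LeafU ` {..<n}"
  proof (rule set_eqI)
    fix y show "y \<in> nbrs G HubU \<longleftrightarrow> y \<in> (\<lambda>i. Inner i 1) ` {..<m} \<union> LeafU ` {..<n}"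
      unfolding A by (cases y) auto
  qed
  show "nbrs G HubV = (\<lambda>i. Inner i (k - 2)) ` {..<m} \<union> LeafV ` {..<n}"
  proof (rule set_eqI)
    fix y show "y \<in> nbrs G HubV \<longleftrightarrow> y \<in> (\<lambda>i. Inner i (k - 2)) ` {..<m} \<union> LeafV ` {..<n}"
      unfolding A using k_ge by (cases y) auto
  qed
  show "nbrs G (Inner i j) = {path_vertex k i (j - 1), path_vertex k i (Suc j)}"
    if "i < m" "0 < j" "Suc j < k"
  proof (rule set_eqI)
    fix y show "y \<in> nbrs G (Inner i j) \<longleftrightarrow> y \<in> {path_vertex k i (j - 1), path_vertex k i (Suc j)}"
      unfolding A using that k_ge by (cases y) (auto simp: path_vertex_def)
  qed
  show "nbrs G (LeafU a) = {HubU}" if "a < n"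
  proof (rule set_eqI)
    fix y show "y \<in> nbrs G (LeafU a) \<longleftrightarrow> y \<in> {HubU}"
      unfolding A using that by (cases y) auto
  qed
  show "nbrs G (LeafV a) = {HubV}" if "a < n"
  proof (rule set_eqI)
    fix y show "y \<in> nbrs G (LeafV a) \<longleftrightarrow> y \<in> {HubV}"
      unfolding A using that by (cases y) auto
  qed
qed

lemma deg_G:
  "deg G HubU = m + n" "deg G HubV = m + n"
  "i < m \<Longrightarrow> 0 < j \<Longrightarrow> Suc j < k \<Longrightarrow> deg G (Inner i j) = 2"
  "a < n \<Longrightarrow> deg G (LeafU a) = 1" "a < n \<Longrightarrow> deg G (LeafV a) = 1"
proof -
  have "card ((\<lambda>i. Inner i j) ` {..<m} \<union> LeafU ` {..<n}) = m + n"
    "card ((\<lambda>i. Inner i j) ` {..<m} \<union> LeafV ` {..<n}) = m + n" for j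
    by (subst card_Un_disjoint; auto simp: card_image inj_on_def)+
  then show "deg G HubU = m + n" "deg G HubV = m + n"
    by (simp_all add: deg_def nbrs_G)
  show "deg G (Inner i j) = 2" if "i < m" "0 < j" "Suc j < k"
    using that by (auto simp: deg_def nbrs_G path_vertex_def)
qed (simp_all add: deg_def nbrs_G)

lemma mirror_mirror: "x \<in> verts G \<Longrightarrow> mirror k (mirror k x) = x"
  by (cases x) auto

lemma mirror_mem_verts: "x \<in> verts G \<Longrightarrow> mirror k x \<in> verts G"
  by (cases x) auto

text \<open>Arcs to leaves keep their direction and arcs along a path reverse it, hence the
  disjunction.\<close>

lemma arc_mirror:
  assumes "arc n m k x y" "x \<in> verts G" "y \<in> verts G"
  shows "arc n m k (mirror k x) (mirror k y) \<or> arc n m k (mirror k y) (mirror k x)"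
  using assms(1)
proof (cases rule: arcE)
  case (path i j)
  then have "Suc (k - Suc (Suc j)) = k - Suc j"
    by simp
  with path show ?thesis by auto
qed (use k_ge in auto)

lemma mirror_edge: "e \<in> edges G \<Longrightarrow> mirror k ` e \<in> edges G"
proof -
  assume e: "e \<in> edges G"
  then obtain x y where xy: "e = {x, y}" "arc n m k x y"
    by (auto simp: edges_G_conv_arc)
  then have "x \<in> verts G" "y \<in> verts G"
    using e simple_graph_edgeD[OF simple_G] by auto
  then show ?thesis
    using arc_mirror[OF xy(2)] by (simp add: xy(1) edge_iff)
qed

lemma iso_map_mirror: "iso_map (mirror k) G G"
  using mirror_edge[of "{_, _}"]
  by (intro iso_map_involution simple_G) (simp_all add: mirror_mirror mirror_mem_verts)

text \<open>Without immediate returns the walk cannot enter a leaf and has no choice at an inner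
  vertex of a path. It therefore follows one path to \<open>HubV\<close>, where it must stop because
  hubs are not allowed inside.\<close>

lemma link_from_HubU:
  assumes "c 0 = HubU" and stop: "c r = HubU \<or> c r = HubV" and r: "0 < r"
    and adj: "\<And>i. i < r \<Longrightarrow> {c i, c (Suc i)} \<in> edges G"
    and inner: "\<And>i. 0 < i \<Longrightarrow> i < r \<Longrightarrow> c i \<noteq> HubU \<and> c i \<noteq> HubV"
    and nb: "\<And>i. Suc (Suc i) \<le> r \<Longrightarrow> c (Suc (Suc i)) \<noteq> c i"
  shows "r = k - 1 \<and> c 0 \<noteq> c r"
proof -
  have nbr: "c (Suc i) \<in> nbrs G (c i)" if "i < r" for i
    using adj[OF that] by (simp add: nbrs_def)
  have "c 1 \<noteq> LeafU a" if "a < n" for a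
  proof
    assume a: "c 1 = LeafU a"
    then have "1 < r"
      using stop r by (cases "r = 1") auto
    then have "c (Suc 1) \<in> nbrs G (LeafU a)"
      using nbr[of 1] a by simp
    then show False
      using nb[of 0] \<open>1 < r\<close> assms(1) that by (simp add: nbrs_G)
  qed
  then obtain i where i: "i < m" "c 1 = Inner i 1"
    using nbr[of 0] r assms(1) by (auto simp: nbrs_G)
  \<comment> \<open>Two consecutive positions are carried along, since the next vertex is the
    neighbour that differs from the previous one.\<close>
  have step: "c t = path_vertex k i t \<and> c (Suc t) = path_vertex k i (Suc t)"
    if "t < r" "Suc t < k" for t
    using that
  proof (induction t)
    case 0
    then show ?case
      using assms(1) i k_ge by (auto simp: path_vertex_def)
  next
    case (Suc t)
    then have IH: "c t = path_vertex k i t" "c (Suc t) = path_vertex k i (Suc t)"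
      by auto
    moreover have "path_vertex k i (Suc t) = Inner i (Suc t)"
      using Suc.prems by (auto simp: path_vertex_def)
    ultimately have "c (Suc (Suc t)) \<in> nbrs G (Inner i (Suc t))"
      using nbr[of "Suc t"] Suc.prems by simp
    then show ?case
      using IH nb[of t] Suc.prems i by (auto simp: nbrs_G)
  qed
  have "k - 1 \<le> r"
  proof (rule ccontr)
    assume "\<not> k - 1 \<le> r"
    then have "c r = Inner i r"
      using step[of "r - 1"] r by (auto simp: path_vertex_def)
    then show False
      using stop by auto
  qed
  then have "c (k - 1) = HubV"
    using step[of "k - 2"] k_ge by (auto simp: path_vertex_def numeral_2_eq_2 Suc_diff_Suc)
  then show ?thesis
    using inner[of "k - 1"] \<open>k - 1 \<le> r\<close> k_ge assms(1) by (cases "k - 1 = r") auto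
qed

text \<open>Phrased with hubs and edges of \<open>G\<close> instead of \<open>link G\<close>, so
  that it applies to links of a card too: their edges are edges of \<open>G\<close>, although the
  degrees have changed.\<close>

lemma link_in_G:
  assumes start: "c 0 = HubU \<or> c 0 = HubV" and stop: "c r = HubU \<or> c r = HubV" and r: "0 < r"
    and adj: "\<And>i. i < r \<Longrightarrow> {c i, c (Suc i)} \<in> edges G"
    and inner: "\<And>i. 0 < i \<Longrightarrow> i < r \<Longrightarrow> c i \<noteq> HubU \<and> c i \<noteq> HubV"
    and nb: "\<And>i. Suc (Suc i) \<le> r \<Longrightarrow> c (Suc (Suc i)) \<noteq> c i"
  shows "r = k - 1 \<and> c 0 \<noteq> c r"
proof (cases "c 0 = HubU")
  case True
  then show ?thesis
    using link_from_HubU assms by blast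
next
  case False
  let ?c = "\<lambda>i. mirror k (c i)"
  have v: "c i \<in> verts G" if "i \<le> r" for i
  proof (cases i)
    case 0
    then show ?thesis using start by auto
  next
    case (Suc i')
    then show ?thesis
      using adj[of i'] that simple_graph_edgeD[OF simple_G] by simp
  qed
  have hub: "mirror k x = HubV \<longleftrightarrow> x = HubU" "mirror k x = HubU \<longleftrightarrow> x = HubV" for x
    by (cases x; simp)+
  have "{?c i, ?c (Suc i)} \<in> edges G" if "i < r" for i
    using mirror_edge[OF adj[OF that]] by simp
  moreover have "?c (Suc (Suc i)) \<noteq> ?c i" if "Suc (Suc i) \<le> r" for i
    using nb[OF that] v that mirror_mirror by (metis Suc_leD)
  ultimately have "r = k - 1 \<and> ?c 0 \<noteq> ?c r"
    using False start stop r inner by (intro link_from_HubU) (auto simp: hub)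
  then show ?thesis
    by auto
qed

lemma deg_G_ge_3_iff: "3 \<le> deg G x \<longleftrightarrow> x = HubU \<or> x = HubV"
proof
  assume "3 \<le> deg G x"
  then have "x \<in> verts G"
    using deg_pos_imp_verts[OF simple_G, of x] by simp
  with \<open>3 \<le> deg G x\<close> show "x = HubU \<or> x = HubV"
    by (cases x) (auto simp: deg_G)
qed (use m_ge in \<open>auto simp: deg_G\<close>)

lemma not_iso_of_link:
  assumes "simple_graph X" and "link X c r" and "c 0 = c r \<or> r \<noteq> k - 1"
  shows "\<not> graph_iso G X"
proof
  assume "graph_iso G X"
  then obtain f where "iso_map f X G"
    using graph_iso_sym[OF simple_G] by (auto simp: graph_iso_iff_iso_map)
  then have l: "link G (f \<circ> c) r"
    using iso_map_link assms by blast
  have "r = k - 1 \<and> (f \<circ> c) 0 \<noteq> (f \<circ> c) r"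
  proof (rule link_in_G)
    show "(f \<circ> c) 0 = HubU \<or> (f \<circ> c) 0 = HubV" "(f \<circ> c) r = HubU \<or> (f \<circ> c) r = HubV"
      using l by (simp_all add: link_def deg_G_ge_3_iff)
    show "(f \<circ> c) i \<noteq> HubU \<and> (f \<circ> c) i \<noteq> HubV" if "0 < i" "i < r" for i
    proof -
      have "\<not> 3 \<le> deg G ((f \<circ> c) i)"
        using l that by (auto simp: link_def)
      then show ?thesis
        using deg_G_ge_3_iff by blast
    qed
  qed (use l in \<open>auto simp: link_def\<close>)
  then show False
    using assms(3) by auto
qed

lemma deg_delete_G: "e \<in> edges G \<Longrightarrow> deg (delete_edge G e) x = deg G x - (if x \<in> e then 1 else 0)"
  by (rule deg_delete_edge[OF simple_G])

text \<open>A hub loses at most one of its \<open>m + n \<ge> 4\<close> edges, so hubs stay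
  recognisable by degree in every card.\<close>

lemma deg_delete_G_ge_3_iff:
  assumes "e \<in> edges G"
  shows "3 \<le> deg (delete_edge G e) x \<longleftrightarrow> x = HubU \<or> x = HubV"
proof
  assume "3 \<le> deg (delete_edge G e) x"
  then have "3 \<le> deg G x"
    using deg_delete_G[OF assms, of x] by simp
  then show "x = HubU \<or> x = HubV"
    by (simp add: deg_G_ge_3_iff)
qed (use assms n_pos m_ge in \<open>auto simp: deg_delete_G deg_G\<close>)

definition pendant :: "broom_vertex set \<Rightarrow> bool" where
  "pendant e \<longleftrightarrow> (\<exists>a. LeafU a \<in> e \<or> LeafV a \<in> e)"

text \<open>The leaves stay attached as the edge is not pendant, and a link of the card is a walk in
  \<open>G\<close> between hubs.\<close>

lemma broomlike_delete_edge:
  assumes e: "e \<in> edges G" and np: "\<not> pendant e"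
  shows "broomlike n k (delete_edge G e)"
  unfolding broomlike_def
proof (intro conjI allI impI)
  let ?D = "delete_edge G e"
  note finD = finite_leaves[OF simple_delete_edge[OF simple_G]]
  fix h assume "3 \<le> deg ?D h"
  then have "h = HubU \<or> h = HubV"
    using e by (simp add: deg_delete_G_ge_3_iff)
  then show "n \<le> card (leaves ?D h)"
  proof
    assume h: "h = HubU"
    have "LeafU ` {..<n} \<subseteq> leaves ?D h"
      using np e by (auto simp: h leaves_def nbrs_def edge_iff deg_delete_G deg_G pendant_def)
    then have "card (LeafU ` {..<n}) \<le> card (leaves ?D h)"
      by (rule card_mono[OF finD])
    then show ?thesis
      by (simp add: card_image inj_on_def)
  next
    assume h: "h = HubV"
    have "LeafV ` {..<n} \<subseteq> leaves ?D h"
      using np e by (auto simp: h leaves_def nbrs_def edge_iff deg_delete_G deg_G pendant_def)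
    then have "card (LeafV ` {..<n}) \<le> card (leaves ?D h)"
      by (rule card_mono[OF finD])
    then show ?thesis
      by (simp add: card_image inj_on_def)
  qed
next
  fix c r assume l: "link (delete_edge G e) c r"
  have "r = k - 1 \<and> c 0 \<noteq> c r"
  proof (rule link_in_G)
    show "c 0 = HubU \<or> c 0 = HubV" "c r = HubU \<or> c r = HubV"
      using l by (simp_all add: link_def deg_delete_G_ge_3_iff[OF e])
    show "c i \<noteq> HubU \<and> c i \<noteq> HubV" if "0 < i" "i < r" for i
    proof -
      have "\<not> 3 \<le> deg (delete_edge G e) (c i)"
        using l that by (auto simp: link_def)
      then show ?thesis
        using deg_delete_G_ge_3_iff[OF e] by blast
    qed
  qed (use l in \<open>auto simp: link_def\<close>)
  then show "r = k - 1" "c 0 \<noteq> c r"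
    by auto
qed

end

section \<open>Graphs sharing a card with a broom\<close>

lemma iso_map_twins:
  assumes X: "simple_graph X" and pq: "p \<in> verts X" "q \<in> verts X" and twins: "nbrs X p = nbrs X q"
  shows "iso_map (id(p := q, q := p)) X X"
proof -
  define \<tau> where "\<tau> = id(p := q, q := p)"
  have \<tau>: "\<tau> p = q" "\<tau> q = p" "z \<noteq> p \<Longrightarrow> z \<noteq> q \<Longrightarrow> \<tau> z = z" for z
    by (auto simp: \<tau>_def)
  have inv: "\<tau> (\<tau> z) = z" for z
    using \<tau> by metis
  have ne: "p \<notin> nbrs X p" "q \<notin> nbrs X p"
    using nbrs_subset[OF X] twins by auto
  have move: "{\<tau> x, \<tau> y} \<in> edges X" if "{x, y} \<in> edges X" for x y
  proof -
    have xy: "y \<in> nbrs X x" "x \<in> nbrs X y"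
      using that by (auto simp: nbrs_def insert_commute)
    have "\<tau> y \<in> nbrs X (\<tau> x)"
    proof (cases "x = p \<or> x = q")
      case True
      then have "y \<in> nbrs X p"
        using xy twins by auto
      then have "\<tau> y = y" "y \<in> nbrs X q"
        using ne twins \<tau> by metis+
      with True \<open>y \<in> nbrs X p\<close> show ?thesis
        using \<tau> by auto
    next
      case False
      then have "\<tau> x = x"
        using \<tau> by simp
      moreover have "nbrs X (\<tau> y) = nbrs X y"
        using \<tau> twins by metis
      ultimately show ?thesis
        using xy mem_nbrs_commute by metis
    qed
    then show ?thesis
      by (simp add: nbrs_def)
  qed
  have "\<tau> z \<in> verts X" if "z \<in> verts X" for z
    using that pq \<tau> by metis
  then show ?thesis
    unfolding \<tau>_def[symmetric] using inv move by (intro iso_map_involution[OF X]) auto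
qed

text \<open>The transposition of the twins moves one edge to the other; this is how a witness gets
  two edges with the same card.\<close>

lemma da_ecard_twins:
  assumes X: "simple_graph X" and pq: "p \<in> verts X" "q \<in> verts X" and twins: "nbrs X p = nbrs X q"
    and w: "{w, p} \<in> edges X"
  shows "da_ecard X {w, q} = da_ecard X {w, p}"
proof -
  have "w \<in> nbrs X p"
    using w by (simp add: nbrs_def insert_commute)
  then have "w \<noteq> p" "w \<noteq> q"
    using nbrs_subset[OF X] twins by auto
  then have "(id(p := q, q := p)) ` {w, p} = {w, q}"
    by auto
  then show ?thesis
    using iso_map_da_ecard[OF X iso_map_twins[OF X pq twins] w] by simp
qed

text \<open>With both edges present \<open>p\<close> and \<open>q\<close> are twins, and their
  transposition exchanges \<open>{w, p}\<close> and \<open>{w, q}\<close>; so deleting either of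
  them gives isomorphic graphs.\<close>

lemma graph_iso_replace_edge_twins:
  assumes X: "simple_graph X" and e: "{w, p} \<in> edges X" and q: "q \<in> verts X" "{w, q} \<notin> edges X"
    and nb: "nbrs X p = insert w (nbrs X q)" and wq: "w \<noteq> q"
  shows "graph_iso X (replace_edge X {w, p} {w, q})"
proof -
  let ?Y = "X\<lparr>edges := insert {w, q} (edges X)\<rparr>"
  have wp: "w \<noteq> p" "w \<in> verts X" "p \<in> verts X"
    using simple_graph_edgeD[OF X e] by auto
  have pq: "p \<noteq> q"
    using e q by auto
  have Y: "simple_graph ?Y"
    using X q wp wq by (auto simp: simple_graph_def)
  have "nbrs ?Y p = nbrs X p" "nbrs ?Y q = insert w (nbrs X q)"
    using wp wq pq by (auto simp: nbrs_def doubleton_eq_iff)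
  then have "iso_map (id(p := q, q := p)) ?Y ?Y"
    using nb wp q by (intro iso_map_twins[OF Y]) auto
  then have "iso_map (id(p := q, q := p)) (delete_edge ?Y {w, q})
      (delete_edge ?Y ((id(p := q, q := p)) ` {w, q}))"
    by (intro iso_map_delete_edge[OF Y]) auto
  moreover have "(id(p := q, q := p)) ` {w, q} = {w, p}"
    using wp wq pq by auto
  moreover have "delete_edge ?Y {w, q} = X"
    using q by (simp add: delete_edge_def)
  moreover have "{w, q} \<noteq> {w, p}"
    using q e by auto
  then have "insert {w, q} (edges X) - {{w, p}} = insert {w, q} (edges X - {{w, p}})"
    by blast
  then have "delete_edge ?Y {w, p} = replace_edge X {w, p} {w, q}"
    by (simp add: delete_edge_def replace_edge_def)
  ultimately show ?thesis
    by (auto simp: graph_iso_iff_iso_map)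
qed

section \<open>Pairs whose joining gives a graph not isomorphic to the broom\<close>

context broom
begin

definition shared :: "'a ugraph \<Rightarrow> 'a set set" where
  "shared H = {f \<in> edges H. da_ecard H f \<in> da_ecard G ` edges G}"

text \<open>Edges of \<open>G\<close> are excluded as new pairs: \<open>e\<close> would give back
  \<open>G\<close>, and the others are still present in the card.\<close>

definition admissible :: "broom_vertex set \<Rightarrow> broom_vertex \<Rightarrow> broom_vertex \<Rightarrow> bool" where
  "admissible e x y \<longleftrightarrow> e \<in> edges G \<and> x \<in> verts G \<and> y \<in> verts G \<and> x \<noteq> y \<and> {x, y} \<notin> edges G \<and>
     deg (delete_edge G e) x + deg (delete_edge G e) y = edge_degree G e \<and>
     \<not> graph_iso G (replace_edge G e {x, y})"

lemma admissible_simple: "admissible e x y \<Longrightarrow> simple_graph (replace_edge G e {x, y})"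
  by (simp add: admissible_def simple_replace_edge simple_G)

lemma admissible_commute: "admissible e x y \<longleftrightarrow> admissible e y x"
  by (auto simp: admissible_def insert_commute)

lemma deg_admissible:
  "admissible e x y \<Longrightarrow> deg (replace_edge G e {x, y}) z
    = deg G z - (if z \<in> e then 1 else 0) + (if z \<in> {x, y} then 1 else 0)"
  by (simp add: admissible_def deg_replace_edge simple_G deg_delete_G)

lemma da_ecard_eq_imp_admissible:
  assumes H: "simple_graph H" "\<not> graph_iso G H" and e: "e \<in> edges G" and f: "f \<in> edges H"
    and eq: "da_ecard H f = da_ecard G e"
  obtains x y where "admissible e x y" "graph_iso H (replace_edge G e {x, y})"
proof -
  obtain x y where xy: "x \<in> verts G" "y \<in> verts G" "x \<noteq> y" "{x, y} \<notin> edges G - {e}"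
    "deg (delete_edge G e) x + deg (delete_edge G e) y = edge_degree G e"
    "graph_iso H (replace_edge G e {x, y})"
    using da_ecard_eq_imp_iso_replace_edge[OF simple_G H(1) e f] eq by metis
  have n_iso: "\<not> graph_iso G (replace_edge G e {x, y})"
    using H xy(6) graph_iso_sym graph_iso_trans by metis
  have "{x, y} \<noteq> e"
  proof
    assume "{x, y} = e"
    then have "replace_edge G e {x, y} = G"
      using e by (simp add: replace_edge_def insert_absorb)
    then show False
      using n_iso graph_iso_refl by metis
  qed
  then show thesis
    using that xy n_iso e by (auto simp: admissible_def)
qed

lemma overlap_le_card_shared:
  "simple_graph H \<Longrightarrow> shared H \<subseteq> S \<Longrightarrow> finite S \<Longrightarrow> overlap G H \<le> card S"
  using overlap_le_card[OF simple_G] by (simp add: shared_def)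

lemma mirror_replace:
  assumes "e \<in> edges G"
  shows "iso_map (mirror k) (replace_edge G e {x, y})
    (replace_edge G (mirror k ` e) {mirror k x, mirror k y})"
  using iso_map_replace_edge[OF simple_G iso_map_mirror assms, of "{x, y}"] by simp

lemma admissible_mirror:
  assumes a: "admissible e x y"
  shows "admissible (mirror k ` e) (mirror k x) (mirror k y)"
    "overlap G (replace_edge G (mirror k ` e) {mirror k x, mirror k y})
      = overlap G (replace_edge G e {x, y})"
proof -
  have e: "e \<in> edges G" "x \<in> verts G" "y \<in> verts G"
    using a by (auto simp: admissible_def)
  note iso = mirror_replace[OF e(1), of x y]
  note D = simple_delete_edge[OF simple_G, of e]
  note isoD = iso_map_delete_edge[OF simple_G iso_map_mirror e(1)]
  have "\<not> graph_iso G (replace_edge G (mirror k ` e) {mirror k x, mirror k y})"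
    using a iso admissible_simple[OF a] graph_iso_sym graph_iso_trans
    unfolding admissible_def graph_iso_iff_iso_map by metis
  moreover have "mirror k x \<noteq> mirror k y"
    using a mirror_mirror unfolding admissible_def by metis
  moreover have "{mirror k x, mirror k y} \<notin> edges G"
    using a iso_map_edge_iff[OF simple_G iso_map_mirror, of "{x, y}"] e by (simp add: admissible_def)
  ultimately show "admissible (mirror k ` e) (mirror k x) (mirror k y)"
    using a e iso_map_deg[OF D isoD] iso_map_edge_degree[OF simple_G iso_map_mirror e(1)]
    by (simp add: admissible_def mirror_mem_verts mirror_edge)
  show "overlap G (replace_edge G (mirror k ` e) {mirror k x, mirror k y})
      = overlap G (replace_edge G e {x, y})"
    using overlap_graph_iso[OF admissible_simple[OF a]] iso
    unfolding graph_iso_iff_iso_map by metis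
qed

lemma edgeE:
  assumes "e \<in> edges G"
  obtains (start) i where "e = {HubU, Inner i (Suc 0)}" "i < m"
    | (leafU) a where "e = {HubU, LeafU a}" "a < n"
    | (leafV) a where "e = {HubV, LeafV a}" "a < n"
    | (path) i j where "e = {Inner i j, Inner i (Suc j)}" "i < m" "0 < j" "Suc (Suc j) < k"
    | (stop) i j where "e = {Inner i j, HubV}" "i < m" "0 < j" "Suc (Suc j) = k"
proof -
  obtain x y where "e = {x, y}" "arc n m k x y"
    using assms by (auto simp: edges_G_conv_arc)
  from this(2) show thesis
    by (cases rule: arcE) (use that \<open>e = {x, y}\<close> in auto)
qed

lemma edge_degree_G:
  "i < m \<Longrightarrow> edge_degree G {HubU, Inner i (Suc 0)} = m + n"
  "a < n \<Longrightarrow> edge_degree G {HubU, LeafU a} = m + n - 1"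
  "a < n \<Longrightarrow> edge_degree G {HubV, LeafV a} = m + n - 1"
  "i < m \<Longrightarrow> 0 < j \<Longrightarrow> Suc (Suc j) < k \<Longrightarrow> edge_degree G {Inner i j, Inner i (Suc j)} = 2"
proof -
  show "edge_degree G {HubU, Inner i (Suc 0)} = m + n" if "i < m"
    using that k_ge edge_degree_conv_deg[OF simple_G, of HubU "Inner i (Suc 0)"]
    by (simp add: edge_iff deg_G)
  show "edge_degree G {HubU, LeafU a} = m + n - 1" if "a < n"
    using that m_ge edge_degree_conv_deg[OF simple_G, of HubU "LeafU a"]
    by (simp add: edge_iff deg_G)
  show "edge_degree G {HubV, LeafV a} = m + n - 1" if "a < n"
    using that m_ge edge_degree_conv_deg[OF simple_G, of HubV "LeafV a"]
    by (simp add: edge_iff deg_G)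
  show "edge_degree G {Inner i j, Inner i (Suc j)} = 2" if "i < m" "0 < j" "Suc (Suc j) < k"
    using that edge_degree_conv_deg[OF simple_G, of "Inner i j" "Inner i (Suc j)"]
    by (simp add: edge_iff deg_G)
qed

lemma deg_pos_delete_iff:
  assumes e: "e \<in> edges G"
  shows "(\<forall>z\<in>verts G. 0 < deg (delete_edge G e) z) \<longleftrightarrow> \<not> pendant e"
proof
  assume pos: "\<forall>z\<in>verts G. 0 < deg (delete_edge G e) z"
  show "\<not> pendant e"
  proof
    assume "pendant e"
    then obtain z where z: "z \<in> e" "(\<exists>a. z = LeafU a) \<or> (\<exists>a. z = LeafV a)"
      by (auto simp: pendant_def)
    then have "z \<in> verts G"
      using e simple_G by (auto simp: simple_graph_def)
    moreover from this have "deg G z = 1"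
      using z by (auto simp: deg_G)
    ultimately show False
      using pos z e by (auto simp: deg_delete_G)
  qed
next
  assume np: "\<not> pendant e"
  show "\<forall>z\<in>verts G. 0 < deg (delete_edge G e) z"
  proof
    fix z assume "z \<in> verts G"
    with np show "0 < deg (delete_edge G e) z"
      using m_ge by (cases z) (auto simp: deg_delete_G[OF e] deg_G pendant_def)
  qed
qed

text \<open>The degrees in the card add up to \<open>m + n - 1\<close>. \<open>HubV\<close> alone
  exceeds this. \<open>HubU\<close> and the cut-off leaf have degrees \<open>m + n - 1\<close> and 0
  and could only be paired with each other, which restores the deleted edge.\<close>

lemma admissible_leafU:
  assumes a: "admissible {HubU, LeafU a} x y" and an: "a < n"
  shows "x \<notin> {HubU, HubV, LeafU a}" "deg G x \<le> 2" "deg G x + deg G y = m + n - 1"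
    and "y \<notin> {HubU, HubV, LeafU a}" "deg G y \<le> 2"
proof -
  have main: "x \<notin> {HubU, HubV, LeafU a}" if a: "admissible {HubU, LeafU a} x y" for x y
  proof -
    have e: "{HubU, LeafU a} \<in> edges G" and v: "x \<in> verts G" "y \<in> verts G"
      and n_edge: "{x, y} \<notin> edges G"
      using a by (auto simp: admissible_def)
    have s: "deg (delete_edge G {HubU, LeafU a}) x + deg (delete_edge G {HubU, LeafU a}) y = m + n - 1"
      using a an by (simp add: admissible_def edge_degree_G)
    have "x \<noteq> HubV"
      using s e m_ge by (auto simp: deg_delete_G deg_G)
    moreover have "x \<noteq> HubU"
    proof
      assume x: "x = HubU"
      then have "deg (delete_edge G {HubU, LeafU a}) y = 0"
        using s e m_ge by (auto simp: deg_delete_G deg_G)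
      then have "y = LeafU a"
        using v m_ge by (cases y) (auto simp: deg_delete_G[OF e] deg_G split: if_splits)
      then show False
        using x e n_edge by auto
    qed
    moreover have "x \<noteq> LeafU a"
    proof
      assume x: "x = LeafU a"
      then have "deg (delete_edge G {HubU, LeafU a}) y = m + n - 1"
        using s e an by (simp add: deg_delete_G deg_G)
      then have "y = HubU"
        using v m_ge n_pos by (cases y) (auto simp: deg_delete_G[OF e] deg_G split: if_splits)
      then show False
        using x e n_edge by (auto simp: insert_commute)
    qed
    ultimately show ?thesis by simp
  qed
  show x: "x \<notin> {HubU, HubV, LeafU a}"
    using main[OF a] .
  show y: "y \<notin> {HubU, HubV, LeafU a}"
    using main a admissible_commute by blast
  have "\<not> 3 \<le> deg G x" "\<not> 3 \<le> deg G y"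
    using x y unfolding deg_G_ge_3_iff by auto
  then show "deg G x \<le> 2" "deg G y \<le> 2"
    by auto
  have e: "{HubU, LeafU a} \<in> edges G"
    using a by (simp add: admissible_def)
  show "deg G x + deg G y = m + n - 1"
    using a an x y by (simp add: admissible_def edge_degree_G deg_delete_G[OF e])
qed

lemma admissible_pendant_isolated:
  assumes a: "admissible e x y" and p: "pendant e"
  shows "\<exists>z\<in>verts G. deg (replace_edge G e {x, y}) z = 0"
proof -
  have e: "e \<in> edges G"
    using a by (simp add: admissible_def)
  have U: "\<exists>z\<in>verts G. deg (replace_edge G {HubU, LeafU b} {x, y}) z = 0"
    if a: "admissible {HubU, LeafU b} x y" and b: "b < n" for b x y
    using admissible_leafU[OF that] b
    by (intro bexI[of _ "LeafU b"]) (auto simp: deg_admissible[OF a] deg_G)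
  show ?thesis
    using e
  proof (cases rule: edgeE)
    case (leafU b)
    then show ?thesis
      using U a by simp
  next
    case (leafV b)
    then have "mirror k ` e = {HubU, LeafU b}"
      by simp
    then obtain z where z: "z \<in> verts G"
        "deg (replace_edge G (mirror k ` e) {mirror k x, mirror k y}) z = 0"
      using U[of b] admissible_mirror(1)[OF a] leafV by auto
    then have "z = mirror k (mirror k z)" "mirror k z \<in> verts G"
      by (simp_all add: mirror_mirror mirror_mem_verts)
    then show ?thesis
      using z iso_map_deg[OF admissible_simple[OF a] mirror_replace[OF e], of "mirror k z"]
      by (intro bexI[of _ "mirror k z"]) auto
  qed (use p in \<open>auto simp: pendant_def\<close>)
qed

text \<open>An isolated vertex of the new graph decides: it is present whenever the graph arises
  from the card of a pendant edge, and it persists in all cards. So either all common cards come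
  from pendant edges of \<open>G\<close> or none does.\<close>

lemma pendant_iff_of_da_ecard_eq:
  assumes a: "admissible e x y" and f: "f \<in> edges (replace_edge G e {x, y})"
    and e': "e' \<in> edges G" and eq: "da_ecard (replace_edge G e {x, y}) f = da_ecard G e'"
  shows "pendant e' \<longleftrightarrow> pendant e"
proof
  let ?H = "replace_edge G e {x, y}"
  note H = admissible_simple[OF a]
  have e: "e \<in> edges G" and n_iso: "\<not> graph_iso G ?H"
    using a by (auto simp: admissible_def)
  {
    assume "pendant e'"
    obtain p q where pq: "admissible e' p q" "graph_iso ?H (replace_edge G e' {p, q})"
      using da_ecard_eq_imp_admissible[OF H n_iso e' f eq] by metis
    then obtain \<psi> where \<psi>: "iso_map \<psi> ?H (replace_edge G e' {p, q})"
      by (auto simp: graph_iso_iff_iso_map)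
    obtain z where z: "z \<in> verts G" "deg (replace_edge G e' {p, q}) z = 0"
      using admissible_pendant_isolated[OF pq(1) \<open>pendant e'\<close>] by auto
    then obtain z' where z': "z' \<in> verts G" "z = \<psi> z'"
      using \<psi> unfolding iso_map_def bij_betw_def by (metis imageE verts_replace_edge)
    then have "deg ?H z' = 0"
      using z iso_map_deg[OF H \<psi>, of z'] by simp
    then have "deg (delete_edge G e) z' = 0"
      by (simp add: deg_admissible[OF a] deg_delete_G[OF e] split: if_splits)
    then show "pendant e"
      using deg_pos_delete_iff[OF e] z' by auto
  }
  assume "pendant e"
  then obtain z where z: "z \<in> verts G" "deg ?H z = 0"
    using admissible_pendant_isolated[OF a] by auto
  obtain \<phi> where \<phi>: "iso_map \<phi> (delete_edge ?H f) (delete_edge G e')"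
    using eq by (auto simp: da_ecard_eq_iff[OF H simple_G] graph_iso_iff_iso_map)
  have "deg (delete_edge ?H f) z = 0"
    using deg_delete_edge[OF H f] z by simp
  then have "deg (delete_edge G e') (\<phi> z) = 0"
    using iso_map_deg[OF simple_delete_edge[OF H] \<phi>] z by simp
  moreover have "\<phi> z \<in> verts G"
    using \<phi> z by (auto simp: iso_map_def bij_betw_def)
  ultimately show "pendant e'"
    using deg_pos_delete_iff[OF e'] by auto
qed

lemma sharedE:
  assumes a: "admissible e x y" and f: "f \<in> shared (replace_edge G e {x, y})"
  obtains e' \<phi> where "e' \<in> edges G" "pendant e' \<longleftrightarrow> pendant e"
    "iso_map \<phi> (delete_edge (replace_edge G e {x, y}) f) (delete_edge G e')"
proof -
  obtain e' where e': "e' \<in> edges G" "da_ecard (replace_edge G e {x, y}) f = da_ecard G e'"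
    and "f \<in> edges (replace_edge G e {x, y})"
    using f by (auto simp: shared_def)
  moreover from this obtain \<phi> where "iso_map \<phi> (delete_edge (replace_edge G e {x, y}) f) (delete_edge G e')"
    by (auto simp: da_ecard_eq_iff[OF admissible_simple[OF a] simple_G] graph_iso_iff_iso_map)
  ultimately show thesis
    using that pendant_iff_of_da_ecard_eq[OF a] by metis
qed

lemma broomlike_delete_shared:
  assumes a: "admissible e x y" and np: "\<not> pendant e" and f: "f \<in> shared (replace_edge G e {x, y})"
  shows "broomlike n k (delete_edge (replace_edge G e {x, y}) f)"
  using sharedE[OF a f] np iso_map_broomlike[OF simple_delete_edge[OF admissible_simple[OF a]]]
    broomlike_delete_edge by metis

text \<open>The candidates are the second edges of the link seen from its ends, both of them if the
  link is closed. On a triangle they coincide, hence the exception \<open>r = 3\<close>. A superset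
  \<open>L\<close> saves computing the leaves exactly.\<close>

lemma overlap_le_of_link:
  fixes c :: "nat \<Rightarrow> broom_vertex" and x y :: broom_vertex and e :: "broom_vertex set"
  defines "H \<equiv> replace_edge G e {x, y}"
  assumes a: "admissible e x y" and np: "\<not> pendant e"
    and ends: "4 \<le> deg H (c 0)" "4 \<le> deg H (c r)" and r: "2 \<le> r"
    and adj: "\<And>i. i < r \<Longrightarrow> {c i, c (Suc i)} \<in> edges H"
    and inner: "\<And>i. 0 < i \<Longrightarrow> i < r \<Longrightarrow> deg H (c i) = 2"
    and inj: "inj_on c {0..<r}" and ner: "\<And>i. 0 < i \<Longrightarrow> i < r \<Longrightarrow> c i \<noteq> c r"
    and closed: "c 0 = c r \<Longrightarrow> 3 \<le> r" and len: "c 0 = c r \<or> r \<noteq> k - 1"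
    and few: "leaves H (c r) \<subseteq> L" "finite L" "card L < n"
  shows "overlap G H \<le> (if c 0 = c r \<and> r \<noteq> 3 then 2 else 1)"
proof -
  have H: "simple_graph H"
    unfolding H_def using a by (rule admissible_simple)
  have "card (leaves H (c r)) < n"
    using few card_mono le_less_trans by blast
  then have main: "f = {c (r - 2), c (r - 1)} \<or> c 0 = c r \<and> f = {c 1, c 2}" if "f \<in> shared H" for f
    using that broomlike_delete_shared[OF a np]
    by (intro broomlike_delete_edge_on_link[OF H _ _ ends r adj inner inj ner closed len])
      (auto simp: shared_def H_def)
  show ?thesis
  proof (cases "c 0 = c r \<and> r \<noteq> 3")
    case True
    have "overlap G H \<le> card {{c (r - 2), c (r - 1)}, {c 1, c 2}}"
      using main by (intro overlap_le_card_shared[OF H]) auto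
    also have "\<dots> \<le> 2"
      by (simp add: card_insert_if)
    finally show ?thesis
      using True by simp
  next
    case False
    then have "f = {c (r - 2), c (r - 1)}" if "f \<in> shared H" for f
      using main[OF that] by (cases "r = 3") auto
    then have "shared H \<subseteq> {{c (r - 2), c (r - 1)}}"
      by blast
    from overlap_le_card_shared[OF H this] show ?thesis
      using False by auto
  qed
qed


section \<open>New edges that end in a leaf\<close>

lemma path_edge_in_G: "i < m \<Longrightarrow> Suc t < k \<Longrightarrow> {path_vertex k i t, path_vertex k i (Suc t)} \<in> edges G"
  by (auto simp: strong_double_broom_def)

lemma path_vertex_eq_iff:
  "t < k \<Longrightarrow> t' < k \<Longrightarrow> path_vertex k i t = path_vertex k i t' \<longleftrightarrow> t = t'"
  by (auto simp: path_vertex_def)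

text \<open>The new link follows the path up to position \<open>j\<close> and reaches
  \<open>HubV\<close> through the leaf, so its length is \<open>j + 2\<close>. The bound on
  \<open>j\<close> makes this differ from \<open>k - 1\<close> and keeps the loose end
  \<open>Inner i (Suc j)\<close> away from \<open>HubV\<close>, which therefore gains no leaf in
  exchange. Position 0 covers the deletion of an edge at \<open>HubU\<close>.\<close>

lemma overlap_path_to_leafV:
  assumes i: "i < m" and j: "j + 4 \<le> k" and b: "b < n"
    and a: "admissible {path_vertex k i j, path_vertex k i (Suc j)} (path_vertex k i j) (LeafV b)"
  shows "overlap G (replace_edge G {path_vertex k i j, path_vertex k i (Suc j)}
    {path_vertex k i j, LeafV b}) \<le> 1"
proof -
  let ?pv = "path_vertex k i"
  let ?e = "{?pv j, ?pv (Suc j)}"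
  let ?H = "replace_edge G ?e {?pv j, LeafV b}"
  define c where "c t = (if t \<le> j then ?pv t else if t = Suc j then LeafV b else HubV)" for t
  have pv: "?pv 0 = HubU" "0 < t \<Longrightarrow> t \<le> Suc j \<Longrightarrow> ?pv t = Inner i t" for t
    using j by (auto simp: path_vertex_def)
  have pv_j: "?pv j = (if j = 0 then HubU else Inner i j)" "?pv (Suc j) = Inner i (Suc j)"
    using pv by auto
  have c: "c 0 = HubU" "c (Suc (Suc j)) = HubV" "c (Suc j) = LeafV b"
    by (auto simp: c_def pv)
  have c_path: "c t = Inner i t" if "0 < t" "t \<le> j" for t
    using that by (simp add: c_def pv)
  have "overlap G ?H \<le> (if c 0 = c (Suc (Suc j)) \<and> Suc (Suc j) \<noteq> 3 then 2 else 1)"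
  proof (rule overlap_le_of_link[OF a])
    show "\<not> pendant ?e"
      by (auto simp: pendant_def pv_j)
    show "4 \<le> deg ?H (c 0)"
      using m_ge n_pos unfolding c deg_admissible[OF a] deg_G by (auto simp: pv_j)
    show "4 \<le> deg ?H (c (Suc (Suc j)))"
      using m_ge n_pos unfolding c deg_admissible[OF a] deg_G by (auto simp: pv_j)
    show "{c t, c (Suc t)} \<in> edges ?H" if t: "t < Suc (Suc j)" for t
    proof -
      consider "t < j" | "t = j" | "t = Suc j"
        using t by linarith
      then show ?thesis
      proof cases
        case 1
        then have "{?pv t, ?pv (Suc t)} \<noteq> ?e"
          using j by (auto simp: doubleton_eq_iff path_vertex_eq_iff)
        moreover have "{?pv t, ?pv (Suc t)} \<in> edges G"
          using i 1 j by (intro path_edge_in_G) auto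
        ultimately show ?thesis
          using 1 by (simp add: c_def)
      next
        case 3
        then show ?thesis
          using b by (simp add: c edge_iff) (simp add: pv_j doubleton_eq_iff)
      qed (simp add: c_def)
    qed
    show "deg ?H (c t) = 2" if "0 < t" "t < Suc (Suc j)" for t
    proof (cases "t = Suc j")
      case True
      then show ?thesis
        using b unfolding True c deg_admissible[OF a] by (auto simp: pv_j deg_G)
    next
      case False
      then show ?thesis
        using that i j unfolding deg_admissible[OF a] by (auto simp: c_path pv_j deg_G)
    qed
    show "inj_on c {0..<Suc (Suc j)}"
    proof (rule inj_onI)
      fix s t assume "s \<in> {0..<Suc (Suc j)}" "t \<in> {0..<Suc (Suc j)}" "c s = c t"
      then show "s = t"
        using c c_path by (cases "s = 0"; cases "s = Suc j"; cases "t = 0"; cases "t = Suc j") auto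
    qed
    show "c t \<noteq> c (Suc (Suc j))" if "0 < t" "t < Suc (Suc j)" for t
      using that c c_path by (cases "t = Suc j") auto
    show "leaves ?H (c (Suc (Suc j))) \<subseteq> LeafV ` ({..<n} - {b})"
    proof
      fix y assume "y \<in> leaves ?H (c (Suc (Suc j)))"
      then have y: "{HubV, y} \<in> edges ?H" "deg ?H y = 1"
        by (auto simp: c leaves_def nbrs_def)
      from y(1) have "{HubV, y} \<in> edges G"
        by (auto simp: pv_j doubleton_eq_iff split: if_splits)
      with y(2) j m_ge show "y \<in> LeafV ` ({..<n} - {b})"
        unfolding deg_admissible[OF a]
        by (cases y) (auto simp: edge_iff pv_j deg_G split: if_splits)
    qed
    show "card (LeafV ` ({..<n} - {b})) < n"
      using b by (intro card_image_lessThan_diff_less) (auto simp: inj_def)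
  qed (use j in \<open>auto simp: c\<close>)
  then show ?thesis
    by (simp add: c)
qed

text \<open>The beginning of the path and the leaf close a cycle of length \<open>j + 2\<close>
  through \<open>HubU\<close>, a triangle if \<open>j = 1\<close>.\<close>

lemma overlap_path_to_leafU:
  assumes i: "i < m" and j: "0 < j" "Suc (Suc j) < k" and b: "b < n"
    and a: "admissible {Inner i j, Inner i (Suc j)} (Inner i j) (LeafU b)"
  shows "overlap G (replace_edge G {Inner i j, Inner i (Suc j)} {Inner i j, LeafU b})
    \<le> (if j = 1 then 1 else 2)"
proof -
  let ?e = "{Inner i j, Inner i (Suc j)}"
  let ?H = "replace_edge G ?e {Inner i j, LeafU b}"
  define c where "c t = (if t = 0 \<or> t = Suc (Suc j) then HubU
    else if t = Suc j then LeafU b else Inner i t)" for t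
  have c: "c 0 = HubU" "c (Suc (Suc j)) = HubU" "c (Suc j) = LeafU b"
    "0 < t \<Longrightarrow> t \<le> j \<Longrightarrow> c t = Inner i t" for t
    by (auto simp: c_def)
  have "overlap G ?H \<le> (if c 0 = c (Suc (Suc j)) \<and> Suc (Suc j) \<noteq> 3 then 2 else 1)"
  proof (rule overlap_le_of_link[OF a])
    show "\<not> pendant ?e"
      by (auto simp: pendant_def)
    show "4 \<le> deg ?H (c 0)" "4 \<le> deg ?H (c (Suc (Suc j)))"
      using m_ge n_pos unfolding c deg_admissible[OF a] deg_G by auto
    show "{c t, c (Suc t)} \<in> edges ?H" if t: "t < Suc (Suc j)" for t
    proof -
      consider "t = 0" | "0 < t" "t < j" | "t = j" | "t = Suc j"
        using t by linarith
      then show ?thesis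
        using i j b by cases (auto simp: c edge_iff doubleton_eq_iff)
    qed
    show "deg ?H (c t) = 2" if "0 < t" "t < Suc (Suc j)" for t
    proof (cases "t = Suc j")
      case True
      then show ?thesis
        using b unfolding True c(3) deg_admissible[OF a] by (auto simp: deg_G)
    next
      case False
      then show ?thesis
        using that i j unfolding deg_admissible[OF a] by (auto simp: c deg_G)
    qed
    show "inj_on c {0..<Suc (Suc j)}"
    proof (rule inj_onI)
      fix s t assume "s \<in> {0..<Suc (Suc j)}" "t \<in> {0..<Suc (Suc j)}" "c s = c t"
      then show "s = t"
        by (auto simp: c_def split: if_splits)
    qed
    show "c t \<noteq> c (Suc (Suc j))" if "0 < t" "t < Suc (Suc j)" for t
      using that by (auto simp: c_def)
    show "leaves ?H (c (Suc (Suc j))) \<subseteq> LeafU ` ({..<n} - {b})"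
    proof
      fix y assume "y \<in> leaves ?H (c (Suc (Suc j)))"
      then have y: "{HubU, y} \<in> edges G" "deg ?H y = 1"
        by (auto simp: c leaves_def nbrs_def doubleton_eq_iff)
      then show "y \<in> LeafU ` ({..<n} - {b})"
        using j m_ge unfolding deg_admissible[OF a]
        by (cases y) (auto simp: edge_iff deg_G split: if_splits)
    qed
    show "card (LeafU ` ({..<n} - {b})) < n"
      using b by (intro card_image_lessThan_diff_less) (auto simp: inj_def)
  qed (use j in \<open>auto simp: c\<close>)
  then show ?thesis
    by (simp add: c split: if_splits)
qed

text \<open>The triangle at \<open>HubU\<close> uses up two leaves, and at most one is regained: for
  \<open>j = 1\<close> the vertex \<open>Inner i 1\<close> becomes a leaf.\<close>

lemma overlap_leafU_leafU:
  assumes i: "i < m" and j: "0 < j" "Suc (Suc j) < k" and b: "b < n" "b' < n" "b \<noteq> b'"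
    and a: "admissible {Inner i j, Inner i (Suc j)} (LeafU b) (LeafU b')"
  shows "overlap G (replace_edge G {Inner i j, Inner i (Suc j)} {LeafU b, LeafU b'}) \<le> 1"
proof -
  let ?e = "{Inner i j, Inner i (Suc j)}"
  let ?H = "replace_edge G ?e {LeafU b, LeafU b'}"
  define c where "c t = [HubU, LeafU b, LeafU b', HubU] ! t" for t
  have c: "c 0 = HubU" "c (Suc 0) = LeafU b" "c (Suc (Suc 0)) = LeafU b'" "c 3 = HubU"
    by (auto simp: c_def numeral_3_eq_3)
  have less_3: "t = 0 \<or> t = Suc 0 \<or> t = Suc (Suc 0)" if "t < 3" for t :: nat
    using that by linarith
  let ?L = "insert (Inner i 1) (LeafU ` ({..<n} - {b, b'}))"
  have "overlap G ?H \<le> (if c 0 = c 3 \<and> 3 \<noteq> (3::nat) then 2 else 1)"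
  proof (rule overlap_le_of_link[OF a])
    show "\<not> pendant ?e"
      by (auto simp: pendant_def)
    show "4 \<le> deg ?H (c 0)" "4 \<le> deg ?H (c 3)"
      using m_ge n_pos unfolding c deg_admissible[OF a] deg_G by auto
    show "{c t, c (Suc t)} \<in> edges ?H" if "t < 3" for t
      using less_3[OF that] b c by (auto simp: numeral_3_eq_3 edge_iff doubleton_eq_iff)
    show "deg ?H (c t) = 2" if "0 < t" "t < 3" for t
      using less_3[OF that(2)] that(1) b unfolding deg_admissible[OF a] by (auto simp: c deg_G)
    show "inj_on c {0..<3}"
    proof (rule inj_onI)
      fix s t assume "s \<in> {0..<3}" "t \<in> {0..<3}" "c s = c t"
      then show "s = t"
        using less_3[of s] less_3[of t] b by (auto simp: c)
    qed
    show "c t \<noteq> c 3" if "0 < t" "t < 3" for t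
      using less_3[OF that(2)] that(1) c by auto
    show "leaves ?H (c 3) \<subseteq> ?L"
    proof
      fix y assume "y \<in> leaves ?H (c 3)"
      then have y: "{HubU, y} \<in> edges G" "deg ?H y = 1"
        by (auto simp: c leaves_def nbrs_def doubleton_eq_iff)
      then show "y \<in> ?L"
        using j m_ge unfolding deg_admissible[OF a]
        by (cases y) (auto simp: edge_iff deg_G split: if_splits)
    qed
    have "card (LeafU ` ({..<n} - {b, b'})) = n - 2"
      using b by (subst card_image) (auto simp: inj_on_def card_Diff_subset)
    then have "card ?L \<le> Suc (n - 2)"
      by (simp add: card_insert_if)
    then show "card ?L < n"
      using b by linarith
  qed (use j in \<open>auto simp: c\<close>)
  then show ?thesis
    by simp
qed

text \<open>Leaves are counted at \<open>HubV\<close>, where the cut path leaves no new one because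
  \<open>j + 4 \<le> k\<close>; at \<open>HubU\<close> one appears if \<open>j = 1\<close>. The link
  through the two leaves has length 3, which is not \<open>k - 1\<close> since
  \<open>k \<ge> 5\<close>.\<close>

lemma overlap_leafU_leafV:
  assumes i: "i < m" and j: "0 < j" "j + 4 \<le> k" and b: "b < n" "b' < n"
    and a: "admissible {Inner i j, Inner i (Suc j)} (LeafU b) (LeafV b')"
  shows "overlap G (replace_edge G {Inner i j, Inner i (Suc j)} {LeafU b, LeafV b'}) \<le> 1"
proof -
  let ?e = "{Inner i j, Inner i (Suc j)}"
  let ?H = "replace_edge G ?e {LeafU b, LeafV b'}"
  define c where "c t = [HubU, LeafU b, LeafV b', HubV] ! t" for t
  have c: "c 0 = HubU" "c (Suc 0) = LeafU b" "c (Suc (Suc 0)) = LeafV b'" "c 3 = HubV"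
    by (auto simp: c_def numeral_3_eq_3)
  have less_3: "t = 0 \<or> t = Suc 0 \<or> t = Suc (Suc 0)" if "t < 3" for t :: nat
    using that by linarith
  let ?L = "LeafV ` ({..<n} - {b'})"
  have "overlap G ?H \<le> (if c 0 = c 3 \<and> 3 \<noteq> (3::nat) then 2 else 1)"
  proof (rule overlap_le_of_link[OF a])
    show "\<not> pendant ?e"
      by (auto simp: pendant_def)
    show "4 \<le> deg ?H (c 0)" "4 \<le> deg ?H (c 3)"
      using m_ge n_pos unfolding c deg_admissible[OF a] deg_G by auto
    show "{c t, c (Suc t)} \<in> edges ?H" if "t < 3" for t
      using less_3[OF that] b c by (auto simp: numeral_3_eq_3 edge_iff doubleton_eq_iff)
    show "deg ?H (c t) = 2" if "0 < t" "t < 3" for t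
      using less_3[OF that(2)] that(1) b unfolding deg_admissible[OF a] by (auto simp: c deg_G)
    show "inj_on c {0..<3}"
    proof (rule inj_onI)
      fix s t assume "s \<in> {0..<3}" "t \<in> {0..<3}" "c s = c t"
      then show "s = t"
        using less_3[of s] less_3[of t] b by (auto simp: c)
    qed
    show "c t \<noteq> c 3" if "0 < t" "t < 3" for t
      using less_3[OF that(2)] that(1) c by auto
    show "leaves ?H (c 3) \<subseteq> ?L"
    proof
      fix y assume "y \<in> leaves ?H (c 3)"
      then have y: "{HubV, y} \<in> edges G" "deg ?H y = 1"
        by (auto simp: c leaves_def nbrs_def doubleton_eq_iff)
      then show "y \<in> ?L"
        using j m_ge unfolding deg_admissible[OF a]
        by (cases y) (auto simp: edge_iff deg_G split: if_splits)
    qed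
    show "card ?L < n"
      using b by (intro card_image_lessThan_diff_less) (auto simp: inj_def)
  qed (use j in \<open>auto simp: c\<close>)
  then show ?thesis
    by simp
qed

text \<open>\<open>Inner i (Suc j)\<close> is the last inner vertex; apart from the vertex at
  position \<open>j\<close> it has the same neighbour as the leaf, so the two exchange
  roles.\<close>

lemma iso_path_to_leafV:
  assumes i: "i < m" and j: "j + 3 = k" and b: "b < n"
  shows "graph_iso G (replace_edge G {path_vertex k i j, Inner i (Suc j)} {path_vertex k i j, LeafV b})"
proof (rule graph_iso_replace_edge_twins[OF simple_G])
  have pv: "path_vertex k i (Suc j) = Inner i (Suc j)" "path_vertex k i (Suc (Suc j)) = HubV"
    "path_vertex k i j = (if j = 0 then HubU else Inner i j)"
    using j by (auto simp: path_vertex_def)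
  show "{path_vertex k i j, Inner i (Suc j)} \<in> edges G"
    using path_edge_in_G[of i j] i j pv by simp
  show "LeafV b \<in> verts G"
    using b by simp
  show "{path_vertex k i j, LeafV b} \<notin> edges G" "path_vertex k i j \<noteq> LeafV b"
    by (auto simp: edge_iff pv)
  show "nbrs G (Inner i (Suc j)) = insert (path_vertex k i j) (nbrs G (LeafV b))"
    using nbrs_G(3)[of i "Suc j"] nbrs_G(5)[OF b] i j pv by auto
qed

text \<open>An inner vertex is exchanged with a leaf twice, once at each hub. The new path through
  both leaves again has length 3, and the two inner vertices become leaves.\<close>

lemma iso_leafU_leafV:
  assumes i: "i < m" and k: "k = 4" and b: "b < n" "b' < n"
  shows "graph_iso G (replace_edge G {Inner i 1, Inner i 2} {LeafU b, LeafV b'})"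
proof -
  let ?G' = "replace_edge G {Inner i 1, Inner i 2} {Inner i 1, LeafV b'}"
  have "path_vertex k i 1 = Inner i 1"
    using k by (simp add: path_vertex_def)
  then have iso: "graph_iso G ?G'"
    using iso_path_to_leafV[of i 1 b'] i k b by (simp add: numeral_2_eq_2)
  have iso': "graph_iso ?G' (replace_edge ?G' {LeafV b', Inner i 1} {LeafV b', LeafU b})"
  proof (rule graph_iso_replace_edge_twins)
    show "simple_graph ?G'"
      using mem_verts_G(3)[of i 1] mem_verts_G(5)[of b'] i k b
      by (intro simple_replace_edge simple_G) simp_all
    have 2: "path_vertex k i 2 = Inner i 2" "path_vertex k i 0 = HubU"
      using k by (auto simp: path_vertex_def)
    have nb: "nbrs G (Inner i 1) = {HubU, Inner i 2}" "nbrs G (LeafU b) = {HubU}"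
      using nbrs_G(3)[of i 1] nbrs_G(4)[OF b(1)] i k 2 by (simp_all add: numeral_2_eq_2)
    show "nbrs ?G' (Inner i 1) = insert (LeafV b') (nbrs ?G' (LeafU b))"
    proof (rule set_eqI)
      fix z show "z \<in> nbrs ?G' (Inner i 1) \<longleftrightarrow> z \<in> insert (LeafV b') (nbrs ?G' (LeafU b))"
        unfolding mem_nbrs_replace_edge nb doubleton_eq_iff insert_iff by (cases z) simp_all
    qed
  qed (use b in \<open>auto simp: edge_iff doubleton_eq_iff\<close>)
  have eq: "replace_edge ?G' {LeafV b', Inner i 1} {LeafV b', LeafU b}
      = replace_edge G {Inner i 1, Inner i 2} {LeafU b, LeafV b'}"
  proof -
    have swap: "{LeafV b', Inner i 1} = {Inner i 1, LeafV b'}" "{LeafV b', LeafU b} = {LeafU b, LeafV b'}"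
      by (simp_all add: doubleton_eq_iff)
    have "{Inner i 1, LeafV b'} \<notin> edges G - {{Inner i 1, Inner i 2}}"
      by (simp add: edge_iff)
    from Diff_insert_absorb[OF this] show ?thesis
      unfolding swap replace_edge_def by simp
  qed
  show ?thesis
    using graph_iso_trans[OF iso iso'] unfolding eq .
qed


section \<open>Bounds from counting for small \<open>m + n\<close>\<close>

lemma overlap_pendant_of_n_le_1:
  assumes a: "admissible e x y" and p: "pendant e" and n: "n \<le> 1"
  shows "overlap G (replace_edge G e {x, y}) \<le> 2"
proof -
  define H where "H = replace_edge G e {x, y}"
  let ?S = "{{HubU, LeafU 0}, {HubV, LeafV 0}}"
  have H: "simple_graph H"
    unfolding H_def by (rule admissible_simple[OF a])
  have "f \<in> ?S" if f: "f \<in> edges G" "f' \<in> edges H" "da_ecard G f = da_ecard H f'" for f f'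
  proof -
    have "pendant f"
      using pendant_iff_of_da_ecard_eq[OF a _ f(1)] f(2,3) p by (simp add: H_def)
    with f(1) show ?thesis
      by (cases rule: edgeE) (use n in \<open>auto simp: pendant_def\<close>)
  qed
  \<comment> \<open>Edges of \<open>G\<close> are counted here: for \<open>n = 1\<close> only two of
    them are pendant.\<close>
  then have "overlap H G \<le> card ?S"
    by (intro overlap_le_card[OF H simple_G] subsetI) (blast | simp)+
  also have "\<dots> \<le> 2"
    by (simp add: card_insert_if)
  finally show ?thesis
    unfolding H_def[symmetric] by (subst overlap_commute)
qed

text \<open>When the hubs have degree 5 no card has a vertex of degree 3, whereas $x$ and $y$ get degree 3;
  so the edge deleted from the new graph must contain both.\<close>

lemma overlap_pendant_of_5:
  assumes a: "admissible {HubU, LeafU b} x y" and b: "b < n" and mn: "m + n = 5"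
  shows "overlap G (replace_edge G {HubU, LeafU b} {x, y}) \<le> 1"
proof -
  let ?H = "replace_edge G {HubU, LeafU b} {x, y}"
  note H = admissible_simple[OF a]
  note xy = admissible_leafU[OF a b]
  have degH: "deg ?H x = 3" "deg ?H y = 3"
    using xy mn by (auto simp: deg_admissible[OF a])
  have "f = {x, y}" if f: "f \<in> shared ?H" for f
  proof -
    obtain e' \<phi> where e': "e' \<in> edges G" and \<phi>: "iso_map \<phi> (delete_edge ?H f) (delete_edge G e')"
      using sharedE[OF a f] by metis
    have fH: "f \<in> edges ?H"
      using f by (simp add: shared_def)
    have no_3: "deg (delete_edge G e') z \<noteq> 3" for z
    proof
      assume d: "deg (delete_edge G e') z = 3"
      then have "z = HubU \<or> z = HubV"
        using deg_delete_G_ge_3_iff[OF e', of z] by simp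
      then show False
        using d mn by (auto simp: deg_delete_G[OF e'] deg_G split: if_splits)
    qed
    have "z \<in> f" if "z \<in> verts G" "deg ?H z = 3" for z
    proof (rule ccontr)
      assume "z \<notin> f"
      then have "deg (delete_edge ?H f) z = 3"
        using that by (simp add: deg_delete_edge[OF H fH])
      then show False
        using no_3 iso_map_deg[OF simple_delete_edge[OF H] \<phi>, of z] that by simp
    qed
    moreover have "x \<in> verts G" "y \<in> verts G" "x \<noteq> y"
      using a by (simp_all add: admissible_def)
    ultimately show "f = {x, y}"
      using degH by (intro simple_graph_edge_eqI[OF H fH]) simp_all
  qed
  then have "shared ?H \<subseteq> {{x, y}}"
    by (rule subset_singletonI)
  from overlap_le_card_shared[OF H this] show ?thesis
    by simp
qed

text \<open>The vertices of degrees 4 and 3 in a card are the hubs, which are not adjacent; so the inner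
  vertex, which is adjacent to HubV and has degree 3, must lie on the deleted edge.\<close>

lemma overlap_pendant_of_4:
  assumes a: "admissible {HubU, LeafU b} (Inner i (Suc 0)) (LeafV b')" and b: "b < n"
    and mn: "m + n = 4" and k: "k \<le> 3"
  shows "overlap G (replace_edge G {HubU, LeafU b} {Inner i (Suc 0), LeafV b'}) \<le> 1"
proof -
  let ?H = "replace_edge G {HubU, LeafU b} {Inner i (Suc 0), LeafV b'}"
  note H = admissible_simple[OF a]
  have i: "i < m" and b': "b' < n"
    using a by (auto simp: admissible_def)
  have big: "z = HubU \<and> deg ?H z = 3 \<or> z = HubV \<and> deg ?H z = 4 \<or> z = Inner i (Suc 0) \<and> deg ?H z = 3"
    if "3 \<le> deg ?H z" for z
  proof -
    have "z \<in> verts G"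
      using deg_pos_imp_verts[OF H, of z] that by simp
    then show ?thesis
      using that b b' i k unfolding deg_admissible[OF a]
      by (cases z) (auto simp: deg_G mn split: if_splits)
  qed
  have deg_Inner: "deg ?H (Inner i (Suc 0)) = 3"
    using i k_ge deg_G(3)[of i "Suc 0"] by (simp add: deg_admissible[OF a])
  have "f = {Inner i (Suc 0), LeafV b'}" if f: "f \<in> shared ?H" for f
  proof -
    let ?D = "delete_edge ?H f"
    obtain e' \<phi> where e': "e' \<in> edges G" "pendant e'" and \<phi>: "iso_map \<phi> ?D (delete_edge G e')"
      using sharedE[OF a f] by (metis insertI1 insert_commute pendant_def)
    have fH: "f \<in> edges ?H"
      using f by (simp add: shared_def)
    have degD: "deg ?D z = deg ?H z - (if z \<in> f then 1 else 0)" for z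
      by (rule deg_delete_edge[OF H fH])
    have D: "simple_graph ?D"
      using H by (rule simple_delete_edge)
    have deg\<phi>: "deg (delete_edge G e') (\<phi> z) = deg ?D z" if "z \<in> verts G" for z
      using iso_map_deg[OF D \<phi>] that by simp
    have onto: "\<exists>z\<in>verts G. w = \<phi> z" if "w \<in> verts G" for w
      using \<phi> that unfolding iso_map_def bij_betw_def by (metis imageE verts_delete_edge verts_replace_edge)
    \<comment> \<open>A pendant edge meets exactly one hub, so in its card one hub has degree 4 and
      the other degree 3.\<close>
    obtain w4 w3 where w: "w4 \<in> verts G" "deg (delete_edge G e') w4 = 4"
        "w3 \<in> verts G" "deg (delete_edge G e') w3 = 3"
    proof -
      have "HubU \<in> e' \<and> HubV \<notin> e' \<or> HubV \<in> e' \<and> HubU \<notin> e'"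
        using e'(1) by (cases rule: edgeE) (use e'(2) in \<open>auto simp: pendant_def\<close>)
      then show thesis
        using that[of HubV HubU] that[of HubU HubV] by (auto simp: deg_delete_G[OF e'(1)] deg_G mn)
    qed
    obtain z4 where z4: "z4 \<in> verts G" "deg ?D z4 = 4"
      using onto[OF w(1)] w(2) deg\<phi> by metis
    obtain z3 where z3: "z3 \<in> verts G" "deg ?D z3 = 3"
      using onto[OF w(3)] w(4) deg\<phi> by metis
    have "4 \<le> deg ?H z4"
      using z4(2) degD[of z4] by simp
    then have "z4 = HubV" "deg ?H HubV = 4"
      using big[of z4] by auto
    then have "HubV \<notin> f"
      using z4(2) degD[of HubV] by (auto split: if_splits)
    have I: "Inner i (Suc 0) \<in> f"
    proof (rule ccontr)
      assume "Inner i (Suc 0) \<notin> f"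
      then have "deg ?D (Inner i (Suc 0)) = 3"
        using degD[of "Inner i (Suc 0)"] deg_Inner by simp
      moreover have I: "Inner i (Suc 0) \<in> verts G"
        using i k_ge mem_verts_G(3)[of i "Suc 0"] by simp
      ultimately have "{\<phi> HubV, \<phi> (Inner i (Suc 0))} \<subseteq> {HubU, HubV}"
        using deg\<phi>[of "Inner i (Suc 0)"] deg\<phi>[of HubV] z4 \<open>z4 = HubV\<close>
          deg_delete_G_ge_3_iff[OF e'(1), of "\<phi> HubV"]
          deg_delete_G_ge_3_iff[OF e'(1), of "\<phi> (Inner i (Suc 0))"] by auto
      moreover have "{HubV, Inner i (Suc 0)} \<in> edges G"
        unfolding edge_iff using i k k_ge by simp
      then have "{HubV, Inner i (Suc 0)} \<in> edges ?D"
        using \<open>HubV \<notin> f\<close> by (auto simp: doubleton_eq_iff)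
      then have "\<phi> ` {HubV, Inner i (Suc 0)} \<in> edges (delete_edge G e')"
        using iso_map_edge_iff[OF D \<phi>, of "{HubV, Inner i (Suc 0)}"] I by simp
      then have "{\<phi> HubV, \<phi> (Inner i (Suc 0))} \<in> edges G"
        by simp
      ultimately show False
        using simple_graph_edgeD(1)[OF simple_G] by (auto simp: edge_iff)
    qed
    have "3 \<le> deg ?H z3"
      using z3(2) degD[of z3] by simp
    then have "z3 = HubU" "deg ?H HubU = 3"
      using big[of z3] z3(2) degD[of z3] \<open>Inner i (Suc 0) \<in> f\<close> \<open>HubV \<notin> f\<close> by auto
    then have "HubU \<notin> f"
      using z3(2) degD[of HubU] by (auto split: if_splits)
    moreover obtain p q where pq: "f = {p, q}" "p \<noteq> q" "p \<in> verts G" "q \<in> verts G"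
      using simple_graph_edge[OF H fH] by auto
    ultimately obtain q where q: "f = {Inner i (Suc 0), q}" "q \<noteq> HubU" "q \<noteq> HubV"
      using \<open>HubV \<notin> f\<close> I by auto
    \<comment> \<open>For \<open>k = 3\<close> an inner vertex has only hubs as neighbours in
      \<open>G\<close>, so an edge at it without a hub is the new one.\<close>
    then have "{Inner i (Suc 0), q} \<notin> edges G"
      using k by (cases q) (auto simp: edge_iff)
    then show ?thesis
      using fH q by simp
  qed
  then have "shared ?H \<subseteq> {{Inner i (Suc 0), LeafV b'}}"
    by (rule subset_singletonI)
  from overlap_le_card_shared[OF H this] show ?thesis
    by simp
qed

text \<open>\<open>HubU\<close>, \<open>x\<close> and \<open>y\<close> have degree 3 in the new
  graph, but a common card has at most one vertex of degree 3. So the deleted edge contains two of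
  these three vertices, which leaves three candidates.\<close>

lemma overlap_start_inner:
  assumes mn: "m + n = 4" and i: "i < m"
    and a: "admissible {HubU, Inner i (Suc 0)} x y"
    and xy: "x \<noteq> HubU" "x \<noteq> HubV" "y \<noteq> HubU" "y \<noteq> HubV"
    and degxy: "deg (delete_edge G {HubU, Inner i (Suc 0)}) x = 2" "deg (delete_edge G {HubU, Inner i (Suc 0)}) y = 2"
  shows "overlap G (replace_edge G {HubU, Inner i (Suc 0)} {x, y}) \<le> (if k = 3 then 1 else 2)"
proof -
  let ?e = "{HubU, Inner i (Suc 0)}"
  define H where "H = replace_edge G ?e {x, y}"
  note H = admissible_simple[OF a, folded H_def]
  note sharedE = sharedE[OF a, folded H_def]
  have verts_H: "verts H = verts G" and edges_H: "edges H = insert {x, y} (edges G - {?e})"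
    by (simp_all add: H_def)
  have e: "?e \<in> edges G" and ne: "x \<noteq> y" and v: "x \<in> verts G" "y \<in> verts G"
    using a by (auto simp: admissible_def)
  have np: "\<not> pendant ?e"
    by (auto simp: pendant_def)
  have degH: "deg H z = deg (delete_edge G ?e) z + (if z \<in> {x, y} then 1 else 0)" for z
    using a by (simp add: H_def admissible_def deg_replace_edge simple_G)
  have deg3: "deg H HubU = 3" "deg H x = 3" "deg H y = 3"
    using degxy xy mn by (auto simp: degH deg_delete_G[OF e] deg_G)
  have deg_HubV: "deg H HubV = 4"
    using xy mn by (auto simp: degH deg_delete_G[OF e] deg_G)
  have le_3: "deg H z \<le> 3" if "z \<noteq> HubV" for z
  proof -
    have "\<not> 3 \<le> deg (delete_edge G ?e) z" if "z \<noteq> HubU"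
      using deg_delete_G_ge_3_iff[OF e] that \<open>z \<noteq> HubV\<close> by simp
    then show ?thesis
      using deg3 by (cases "z = HubU") (auto simp: degH)
  qed
  have unique: "p = q"
    if f: "f \<in> shared H" and pq: "deg (delete_edge H f) p = 3" "deg (delete_edge H f) q = 3" for f p q
  proof -
    let ?D = "delete_edge H f"
    have fH: "f \<in> edges H"
      using f by (simp add: shared_def)
    have D: "simple_graph ?D"
      using H by (rule simple_delete_edge)
    obtain e' \<phi> where e': "e' \<in> edges G" "\<not> pendant e'" and \<phi>: "iso_map \<phi> ?D (delete_edge G e')"
      using sharedE[OF f] np by metis
    have deg\<phi>: "deg (delete_edge G e') (\<phi> z) = deg ?D z" if "z \<in> verts G" for z
      using iso_map_deg[OF D \<phi>] that by (simp add: verts_H)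
    have onto: "\<exists>z\<in>verts G. w = \<phi> z" if "w \<in> verts G" for w
      using \<phi> that unfolding iso_map_def bij_betw_def by (metis imageE verts_delete_edge verts_H)
    \<comment> \<open>Otherwise both hubs have degree 4 in the card, whereas \<open>H\<close> has no
      vertex but \<open>HubV\<close> of degree above 3.\<close>
    have "HubU \<in> e' \<or> HubV \<in> e'"
    proof (rule ccontr)
      assume "\<not> ?thesis"
      then have d: "deg (delete_edge G e') HubU = 4" "deg (delete_edge G e') HubV = 4"
        using mn by (auto simp: deg_delete_G[OF e'(1)] deg_G)
      have "w = \<phi> HubV" if "w \<in> verts G" "deg (delete_edge G e') w = 4" for w
      proof -
        obtain z where z: "z \<in> verts G" "w = \<phi> z"
          using onto \<open>w \<in> verts G\<close> by blast
        then have "deg ?D z = 4"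
          using that deg\<phi> by simp
        then have "\<not> deg H z \<le> 3"
          using deg_delete_edge[OF H fH, of z] by simp
        then have "z = HubV"
          using le_3[of z] by (cases "z = HubV") simp_all
        then show ?thesis
          using z(2) by simp
      qed
      from this[OF mem_verts_G(1) d(1)] this[OF mem_verts_G(2) d(2)] have "HubU = HubV"
        by (rule trans[OF _ sym])
      then show False
        by simp
    qed
    moreover have "HubU \<notin> e' \<or> HubV \<notin> e'"
      using e'(1) by (cases rule: edgeE) auto
    moreover have "deg (delete_edge G e') HubU = (if HubU \<in> e' then 3 else 4)"
      "deg (delete_edge G e') HubV = (if HubV \<in> e' then 3 else 4)"
      using mn by (simp_all add: deg_delete_G[OF e'(1)] deg_G)
    ultimately have hubs: "deg (delete_edge G e') HubU = 3 \<and> deg (delete_edge G e') HubV = 4 \<or>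
        deg (delete_edge G e') HubU = 4 \<and> deg (delete_edge G e') HubV = 3"
      by (cases "HubU \<in> e'"; cases "HubV \<in> e'") simp_all
    have one: "w = w'" if "deg (delete_edge G e') w = 3" "deg (delete_edge G e') w' = 3" for w w'
    proof -
      have "w = HubU \<or> w = HubV" "w' = HubU \<or> w' = HubV"
        using that deg_delete_G_ge_3_iff[OF e'(1), of w] deg_delete_G_ge_3_iff[OF e'(1), of w'] by simp_all
      then show ?thesis
        using hubs that by (elim disjE) simp_all
    qed
    have "p \<in> verts G" "q \<in> verts G"
      using pq deg_pos_imp_verts[OF D, of p] deg_pos_imp_verts[OF D, of q] by (auto simp: verts_H)
    then show "p = q"
      using one[of "\<phi> p" "\<phi> q"] deg\<phi> pq inj_onD[OF iso_map_inj_on[OF \<phi>], of p q] by (simp add: verts_H)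
  qed
  \<comment> \<open>Deleting \<open>{HubU, p}\<close> leaves \<open>q\<close> with degree 3, so
    \<open>q\<close> needs a leaf neighbour in the card. But \<open>q\<close> is the neighbour of
    \<open>HubU\<close> on another path and has none.\<close>
  have not_both: False
    if f: "{HubU, p} \<in> shared H" and q: "{HubU, q} \<in> edges H" and pq: "{p, q} = {x, y}" for p q
  proof -
    let ?D = "delete_edge H {HubU, p}"
    have fH: "{HubU, p} \<in> edges H"
      using f by (simp add: shared_def)
    have degD: "deg ?D z = deg H z - (if z \<in> {HubU, p} then 1 else 0)" for z
      by (rule deg_delete_edge[OF H fH])
    have q': "q \<noteq> HubU" "q \<noteq> p" "deg H q = 3" "deg H p = 3" "q \<in> verts G" "q \<noteq> HubV"
      using pq xy ne deg3 v by (auto simp: doubleton_eq_iff)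
    have qG: "{HubU, q} \<in> edges G" "{HubU, q} \<noteq> ?e"
      using q pq xy by (auto simp: edges_H doubleton_eq_iff)
    have "deg (delete_edge G ?e) q = 2"
      using pq degxy by (auto simp: doubleton_eq_iff)
    then obtain i' where i': "q = Inner i' (Suc 0)" "i' < m" "i' \<noteq> i"
      using qG q'(1) by (cases q) (auto simp: edge_iff deg_delete_G[OF e] deg_G)
    have "broomlike n k ?D"
      using broomlike_delete_shared[OF a np, folded H_def, OF f] .
    moreover have "3 \<le> deg ?D q"
      using degD[of q] q' by simp
    ultimately have "1 \<le> card (leaves ?D q)"
      using n_pos by (force simp: broomlike_def)
    then obtain w where w: "w \<in> leaves ?D q"
      by (metis card.empty ex_in_conv not_one_le_zero)
    then have wD: "deg ?D w = 1" and wH: "{q, w} \<in> edges H"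
      by (auto simp: leaves_def nbrs_def)
    have "w \<noteq> p" "w \<noteq> HubU" "w \<noteq> HubV"
      using wD degD[of w] q' deg3 deg_HubV by (auto split: if_splits)
    then have "deg H w = 1"
      using wD degD[of w] by simp
    have "{q, w} \<noteq> {x, y}"
      using pq \<open>w \<noteq> p\<close> q' by (auto simp: doubleton_eq_iff)
    then have "{Inner i' (Suc 0), w} \<in> edges G"
      using wH i' by (simp add: edges_H)
    then have "w = Inner i' 2" "3 < k"
      using \<open>w \<noteq> HubU\<close> \<open>w \<noteq> HubV\<close> by (cases w; auto simp: edge_iff)+
    then have "2 \<le> deg H w"
      using i' deg_G(3)[of i' 2] by (simp add: degH deg_delete_G[OF e])
    then show False
      using \<open>deg H w = 1\<close> by simp
  qed
  have cand: "f = {x, y} \<or> f = {HubU, x} \<or> f = {HubU, y}" if f: "f \<in> shared H" for f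
  proof -
    have fH: "f \<in> edges H"
      using f by (simp add: shared_def)
    have out: "deg (delete_edge H f) z = 3" if "deg H z = 3" "z \<notin> f" for z
      using that by (simp add: deg_delete_edge[OF H fH])
    have "p = q" if "p \<in> {HubU, x, y}" "q \<in> {HubU, x, y}" "p \<notin> f" "q \<notin> f" for p q
      using unique[OF f, of p q] out deg3 that by auto
    then have "x \<in> f \<and> y \<in> f \<or> HubU \<in> f \<and> x \<in> f \<or> HubU \<in> f \<and> y \<in> f"
      using ne xy by blast
    then show ?thesis
      using simple_graph_edge_eqI[OF H fH, of x y] simple_graph_edge_eqI[OF H fH, of HubU x]
        simple_graph_edge_eqI[OF H fH, of HubU y] ne xy by blast
  qed
  have "overlap G H \<le> (if k = 3 then 1 else 2)"
  proof (cases "k = 3")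
    case True
    \<comment> \<open>For \<open>k = 3\<close> every inner vertex except the cut-off one is still
      adjacent to \<open>HubU\<close>, so both candidates at \<open>HubU\<close> drop out.\<close>
    have adj: "{HubU, z} \<in> edges H" if "z \<in> {x, y}" for z
    proof -
      have z: "z \<in> verts G" "z \<noteq> HubU" "z \<noteq> HubV" "deg (delete_edge G ?e) z = 2"
        using that v xy degxy by auto
      from z obtain i' j' where "z = Inner i' j'"
        by (cases z) (auto simp: deg_delete_G[OF e] deg_G)
      moreover have "k \<le> 3"
        using True by simp
      ultimately have "{HubU, z} \<in> edges G" "z \<noteq> Inner i (Suc 0)"
        using z by (auto simp: edge_iff deg_delete_G[OF e] deg_G)
      then show ?thesis
        using z(2) by (simp add: edges_H doubleton_eq_iff)
    qed
    have "{HubU, x} \<notin> shared H" "{HubU, y} \<notin> shared H"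
      using not_both[OF _ adj, of x y] not_both[OF _ adj, of y x] by (auto simp: doubleton_eq_iff)
    then have "f = {x, y}" if "f \<in> shared H" for f
      using cand[OF that] that by (elim disjE) simp_all
    then have "shared H \<subseteq> {{x, y}}"
      by (rule subset_singletonI)
    from overlap_le_card_shared[OF H this] show ?thesis
      using True by simp
  next
    case False
    have "\<exists>z. \<forall>f\<in>shared H. f = {x, y} \<or> f = {HubU, z}"
    proof (cases "{HubU, x} \<in> shared H")
      case True
      then have "{HubU, y} \<notin> shared H"
        using not_both[of x y] by (auto simp: shared_def)
      then have "f = {x, y} \<or> f = {HubU, x}" if "f \<in> shared H" for f
        using cand[OF that] that by (elim disjE) simp_all
      then show ?thesis
        by blast
    next
      case False
      then have "f = {x, y} \<or> f = {HubU, y}" if "f \<in> shared H" for f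
        using cand[OF that] that by (elim disjE) simp_all
      then show ?thesis
        by blast
    qed
    then obtain z where "\<forall>f\<in>shared H. f = {x, y} \<or> f = {HubU, z}"
      by blast
    then have "shared H \<subseteq> {{x, y}, {HubU, z}}"
      by (simp add: subset_iff)
    then have "overlap G H \<le> card {{x, y}, {HubU, z}}"
      by (intro overlap_le_card_shared[OF H]) auto
    also have "\<dots> \<le> 2"
      by (simp add: card_insert_if)
    finally show ?thesis
      using False by simp
  qed
  then show ?thesis
    by (simp only: H_def)
qed

end

section \<open>The maximal number of common cards\<close>

context broom
begin

text \<open>The conditions on \<open>m + n\<close> gather the pairs listed in the theorem: as
  \<open>m \<ge> 3\<close> and \<open>n \<ge> 1\<close>, the sum is 4 only for \<open>m = 3\<close>,
  \<open>n = 1\<close>, and it is 5 only for \<open>m = 3\<close>, \<open>n = 2\<close> and for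
  \<open>m = 4\<close>, \<open>n = 1\<close>.\<close>

definition max_overlap :: nat where
  "max_overlap = (if 5 \<le> k \<or> k = 4 \<and> m + n = 4 then 2 else if k = 4 \<or> m + n \<le> 5 then 1 else 0)"

text \<open>Two degrees of at most 2 add up to \<open>m + n - 1\<close>, so \<open>m + n\<close> is
  4 or 5. If it is 4 and \<open>k = 3\<close>, the sum 3 is only reached by an inner vertex and a
  leaf at \<open>HubV\<close>, since \<open>n = 1\<close>.\<close>

lemma overlap_leafU:
  assumes a: "admissible {HubU, LeafU b} x y" and b: "b < n"
  shows "overlap G (replace_edge G {HubU, LeafU b} {x, y}) \<le> max_overlap"
proof -
  note xy = admissible_leafU[OF a b]
  have p: "pendant {HubU, LeafU b}"
    by (auto simp: pendant_def)
  consider "m + n = 5" | "m + n = 4" "4 \<le> k" | "m + n = 4" "k = 3"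
    using xy m_ge n_pos k_ge by linarith
  then show ?thesis
  proof cases
    case 1
    then show ?thesis
      using overlap_pendant_of_5[OF a b] by (auto simp: max_overlap_def)
  next
    case 2
    then have "n \<le> 1"
      using m_ge by simp
    then show ?thesis
      using overlap_pendant_of_n_le_1[OF a p] 2 by (auto simp: max_overlap_def)
  next
    case 3
    have v: "x \<in> verts G" "y \<in> verts G"
      using a by (auto simp: admissible_def)
    have ends: "\<exists>i b'. p = Inner i (Suc 0) \<and> q = LeafV b'"
      if "p \<in> verts G" "p \<notin> {HubU, HubV, LeafU b}" "deg G p \<noteq> 1"
        and "q \<in> verts G" "q \<notin> {HubU, HubV, LeafU b}" "deg G q = 1" for p q
    proof -
      have "k \<le> 3" "n \<le> 1"
        using 3 m_ge by simp_all
      then have "\<exists>i. p = Inner i (Suc 0)" "\<exists>b'. q = LeafV b'"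
        using that b by (cases p; auto simp: deg_G; fail) (use that b \<open>n \<le> 1\<close> in \<open>cases q; auto simp: deg_G\<close>)
      then show ?thesis
        by blast
    qed
    have "deg G x + deg G y = 3"
      using xy 3 by simp
    then consider "deg G x \<noteq> 1" "deg G y = 1" | "deg G y \<noteq> 1" "deg G x = 1"
      using xy by linarith
    then obtain i b' where "admissible {HubU, LeafU b} (Inner i (Suc 0)) (LeafV b')"
      "{x, y} = {Inner i (Suc 0), LeafV b'}"
    proof cases
      case 1
      with ends[OF v(1) xy(1) _ v(2) xy(4)] that a show thesis
        by auto
    next
      case 2
      with ends[OF v(2) xy(4) _ v(1) xy(1)] that a show thesis
        unfolding admissible_commute[of _ x y] insert_commute[of x y] by auto
    qed
    moreover have "k \<le> 3" "1 \<le> max_overlap"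
      unfolding max_overlap_def using 3 by simp_all
    ultimately show ?thesis
      using overlap_pendant_of_4[OF _ b 3(1), of i b'] by simp
  qed
qed

text \<open>The degrees in the card add up to \<open>m + n\<close>. \<open>HubV\<close> would need a
  partner of degree 0, and there is none. \<open>HubU\<close> has degree \<open>m + n - 1\<close>
  and needs a partner of degree 1, which without repeating an edge of \<open>G\<close> is a leaf at
  \<open>HubV\<close>. With no hub involved the sum is at most 4.\<close>

lemma overlap_start:
  assumes a: "admissible {HubU, Inner i (Suc 0)} x y" and i: "i < m"
  shows "overlap G (replace_edge G {HubU, Inner i (Suc 0)} {x, y}) \<le> max_overlap"
proof -
  let ?e = "{HubU, Inner i (Suc 0)}"
  have e: "?e \<in> edges G"
    using a by (simp add: admissible_def)
  have np: "\<not> pendant ?e"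
    by (auto simp: pendant_def)
  have sum: "deg (delete_edge G ?e) x + deg (delete_edge G ?e) y = m + n"
    using a i edge_degree_G(1) by (simp add: admissible_def)
  have pv: "path_vertex k i 0 = HubU" "path_vertex k i (Suc 0) = Inner i (Suc 0)"
    using k_ge by (auto simp: path_vertex_def)
  have pos: "0 < deg (delete_edge G ?e) z" if "z \<in> verts G" for z
    using deg_pos_delete_iff[OF e] np that by blast
  have not_V: "p \<noteq> HubV"
    if "admissible ?e p q" "deg (delete_edge G ?e) p + deg (delete_edge G ?e) q = m + n" for p q
    using pos[of q] that by (auto simp: admissible_def deg_delete_G[OF e] deg_G)
  have from_U: "overlap G (replace_edge G ?e {HubU, q}) \<le> max_overlap"
    if a: "admissible ?e HubU q" and s: "deg (delete_edge G ?e) HubU + deg (delete_edge G ?e) q = m + n" for q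
  proof -
    have q: "q \<in> verts G" "{HubU, q} \<notin> edges G" "q \<noteq> HubU"
      using a by (auto simp: admissible_def)
    have "deg (delete_edge G ?e) q = 1"
      using s m_ge by (simp add: deg_delete_G[OF e] deg_G)
    then have "q \<noteq> HubV" "\<And>i' j'. q = Inner i' j' \<Longrightarrow> q = Inner i (Suc 0)"
      using q m_ge by (auto simp: deg_delete_G[OF e] deg_G split: if_splits)
    with q e obtain b where b: "q = LeafV b" "b < n"
      by (cases q) (auto simp: edge_iff)
    have "k \<noteq> 3"
    proof
      assume "k = 3"
      then have "graph_iso G (replace_edge G ?e {HubU, LeafV b})"
        using iso_path_to_leafV[OF i _ b(2), of 0] pv by simp
      then show False
        using a b by (simp add: admissible_def)
    qed
    then have "overlap G (replace_edge G ?e {HubU, LeafV b}) \<le> 1" "4 \<le> k"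
      using overlap_path_to_leafV[OF i _ b(2), of 0] a b k_ge by (simp_all add: pv)
    then show ?thesis
      using b by (auto simp: max_overlap_def)
  qed
  show ?thesis
  proof (cases "x = HubU \<or> y = HubU")
    case True
    then show ?thesis
    proof
      assume "x = HubU"
      then show ?thesis
        using from_U[of y] a sum by simp
    next
      assume y: "y = HubU"
      have "admissible ?e HubU x"
        using a admissible_commute[of ?e x y] y by simp
      then show ?thesis
        using from_U[of x] sum unfolding y doubleton_commute[of x HubU] by (simp add: add.commute)
    qed
  next
    case False
    have "x \<noteq> HubV" "y \<noteq> HubV"
      using not_V[of x y] not_V[of y x] a sum admissible_commute[of ?e x y]
      by (simp_all add: add.commute)
    then have le: "deg (delete_edge G ?e) x \<le> 2" "deg (delete_edge G ?e) y \<le> 2"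
      using deg_delete_G_ge_3_iff[OF e, of x] deg_delete_G_ge_3_iff[OF e, of y] False by auto
    then have mn: "m + n = 4"
      using sum m_ge n_pos by linarith
    then have "overlap G (replace_edge G ?e {x, y}) \<le> (if k = 3 then 1 else 2)"
      using False le sum \<open>x \<noteq> HubV\<close> \<open>y \<noteq> HubV\<close> by (intro overlap_start_inner[OF _ i a]) auto
    then show ?thesis
      using mn k_ge by (auto simp: max_overlap_def split: if_splits)
  qed
qed

text \<open>The other positions of $x$ and $y$ follow by the mirror symmetry.\<close>

lemma overlap_path_half:
  assumes i: "i < m" and j: "0 < j" "Suc (Suc j) < k"
    and a: "admissible {Inner i j, Inner i (Suc j)} x y"
    and xy: "x = Inner i j \<and> (y = LeafU b \<or> y = LeafV b) \<or>
      x = LeafU b \<and> (y = LeafU b' \<or> y = LeafV b' \<and> (j + 4 \<le> k \<or> k = 4))"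
  shows "overlap G (replace_edge G {Inner i j, Inner i (Suc j)} {x, y}) \<le> max_overlap"
proof -
  let ?H = "replace_edge G {Inner i j, Inner i (Suc j)} {x, y}"
  have v: "x \<in> verts G" "y \<in> verts G" "x \<noteq> y" and n_iso: "\<not> graph_iso G ?H"
    using a by (auto simp: admissible_def)
  have pv: "path_vertex k i j = Inner i j" "path_vertex k i (Suc j) = Inner i (Suc j)"
    using j by (auto simp: path_vertex_def)
  have one: "1 \<le> max_overlap"
    using j by (simp add: max_overlap_def)
  from xy consider "x = Inner i j" "y = LeafU b" | "x = Inner i j" "y = LeafV b"
    | "x = LeafU b" "y = LeafU b'" | "x = LeafU b" "y = LeafV b'" "j + 4 \<le> k"
    | "x = LeafU b" "y = LeafV b'" "k = 4"
    by blast
  then show ?thesis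
  proof cases
    case 1
    then have "overlap G ?H \<le> (if j = 1 then 1 else 2)"
      using overlap_path_to_leafU[OF i j, of b] a v by simp
    then show ?thesis
      using j by (auto simp: max_overlap_def split: if_splits)
  next
    case 2
    then have b: "b < n"
      using v by simp
    show ?thesis
    proof (cases "j + 4 \<le> k")
      case True
      then show ?thesis
        using overlap_path_to_leafV[OF i True b] a 2 one by (simp add: pv)
    next
      case False
      then have "graph_iso G ?H"
        using iso_path_to_leafV[OF i _ b, of j] j 2 by (simp add: pv)
      then show ?thesis
        using n_iso by simp
    qed
  next
    case 3
    then show ?thesis
      using overlap_leafU_leafU[OF i j, of b b'] a v one by simp
  next
    case 4
    then show ?thesis
      using overlap_leafU_leafV[OF i j(1), of b b'] a v one by simp
  next
    case 5
    then have "j = 1"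
      using j by simp
    then have "?H = replace_edge G {Inner i 1, Inner i 2} {LeafU b, LeafV b'}"
      by (simp add: 5(1,2) numeral_2_eq_2)
    moreover have "b < n" "b' < n"
      using v(1,2) by (simp_all add: 5(1,2))
    ultimately show ?thesis
      using iso_leafU_leafV[OF i 5(3)] n_iso by metis
  qed
qed

text \<open>The degrees in the card add up to 2 and neither is 0, so the new edge joins leaves of
  \<open>G\<close> or ends of the deleted edge.\<close>

lemma overlap_path:
  assumes i: "i < m" and j: "0 < j" "Suc (Suc j) < k"
    and a: "admissible {Inner i j, Inner i (Suc j)} x y"
  shows "overlap G (replace_edge G {Inner i j, Inner i (Suc j)} {x, y}) \<le> max_overlap"
proof -
  let ?e = "{Inner i j, Inner i (Suc j)}"
  \<comment> \<open>\<open>P\<close> marks a pair violating the bound; each case is settled by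
    refuting it, directly, with the two vertices exchanged, or after reflection.\<close>
  define P where "P x y \<longleftrightarrow> admissible ?e x y \<and> \<not> overlap G (replace_edge G ?e {x, y}) \<le> max_overlap" for x y
  have e: "?e \<in> edges G" and ne: "x \<noteq> y" "{x, y} \<notin> edges G" and v: "x \<in> verts G" "y \<in> verts G"
    using a by (simp_all add: admissible_def)
  have "{x, y} \<noteq> ?e"
    using e ne(2) by metis
  then have n_e: "\<not> (x = Inner i j \<and> y = Inner i (Suc j))" "\<not> (x = Inner i (Suc j) \<and> y = Inner i j)"
    by (simp_all add: doubleton_eq_iff)
  have commute: "P p q \<Longrightarrow> P q p" for p q
    unfolding P_def admissible_commute[of ?e q p] doubleton_commute[of q p] .
  have half: "\<not> P p q" if "p = Inner i j \<and> (q = LeafU b \<or> q = LeafV b) \<or>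
      p = LeafU b \<and> (q = LeafU b' \<or> q = LeafV b' \<and> (j + 4 \<le> k \<or> k = 4))" for p q b b'
    using overlap_path_half[OF i j _ that] by (auto simp: P_def)
  \<comment> \<open>The reflected edge starts at this position: \<open>mirror\<close> sends
    \<open>Suc j\<close> to \<open>k - 1 - Suc j\<close>.\<close>
  let ?j = "k - 2 - j"
  have j': "0 < ?j" "Suc (Suc ?j) < k" "k - 1 - Suc j = ?j" "k - 1 - j = Suc ?j"
    using j by auto
  have mirror_e: "mirror k ` ?e = {Inner i ?j, Inner i (Suc ?j)}"
    using j' by (simp add: insert_commute)
  have half': "\<not> P p q" if c: "mirror k p = Inner i ?j \<and> (mirror k q = LeafU b \<or> mirror k q = LeafV b) \<or>
      mirror k p = LeafU b \<and> (mirror k q = LeafU b' \<or> mirror k q = LeafV b' \<and> (?j + 4 \<le> k \<or> k = 4))" for p q b b'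
  proof
    assume "P p q"
    then have pq: "admissible ?e p q" "\<not> overlap G (replace_edge G ?e {p, q}) \<le> max_overlap"
      by (simp_all add: P_def)
    show False
      using overlap_path_half[OF i j'(1,2) admissible_mirror(1)[OF pq(1), unfolded mirror_e] c]
        admissible_mirror(2)[OF pq(1), unfolded mirror_e] pq(2) by simp
  qed
  have kinds: "z = Inner i j \<or> z = Inner i (Suc j) \<or> (\<exists>b. z = LeafU b) \<or> (\<exists>b. z = LeafV b)"
    if "z \<in> verts G" "deg (delete_edge G ?e) z \<le> 1" for z
    using that m_ge n_pos by (cases z) (auto simp: deg_delete_G[OF e] deg_G split: if_splits)
  have "\<not> pendant ?e"
    by (auto simp: pendant_def)
  then have "0 < deg (delete_edge G ?e) x" "0 < deg (delete_edge G ?e) y"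
    using deg_pos_delete_iff[OF e] v by auto
  moreover have "deg (delete_edge G ?e) x + deg (delete_edge G ?e) y = 2"
    using a edge_degree_G(4)[OF i j] by (simp add: admissible_def)
  ultimately have "deg (delete_edge G ?e) x \<le> 1" "deg (delete_edge G ?e) y \<le> 1"
    by auto
  note kx = kinds[OF v(1) this(1)] and ky = kinds[OF v(2) this(2)]
  have UV: "\<not> P (LeafU b) (LeafV b')" for b b'
  proof (cases "j + 4 \<le> k \<or> k = 4")
    case True
    then show ?thesis
      using half by blast
  next
    case False
    \<comment> \<open>Here \<open>j = k - 3\<close> and \<open>k \<ge> 5\<close>, so the reflected
      position is 1.\<close>
    then have "?j + 4 \<le> k"
      using j by linarith
    then have "\<not> P (LeafV b') (LeafU b)"
      using half'[of "LeafV b'" "LeafU b" b' b] by simp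
    then show ?thesis
      using commute by blast
  qed
  have IU: "\<not> P (Inner i j) (LeafU b)" "\<not> P (Inner i j) (LeafV b)" "\<not> P (LeafU b) (LeafU b')" for b b'
    using half by blast+
  have IV: "\<not> P (Inner i (Suc j)) (LeafU b)" "\<not> P (Inner i (Suc j)) (LeafV b)"
    "\<not> P (LeafV b) (LeafV b')" for b b'
    using half'[of "Inner i (Suc j)" "LeafU b" b] half'[of "Inner i (Suc j)" "LeafV b" b]
      half'[of "LeafV b" "LeafV b'" b b'] j' by simp_all
  have "\<not> P x y"
  proof
    assume xy: "P x y"
    then have yx: "P y x"
      by (rule commute)
    from kx show False
    proof (elim disjE exE)
      assume x: "x = Inner i j"
      from ky show False
        by (elim disjE exE) (use xy x ne(1) n_e IU(1,2) in auto)
    next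
      assume x: "x = Inner i (Suc j)"
      from ky show False
        by (elim disjE exE) (use xy x ne(1) n_e IV(1,2) in auto)
    next
      fix b assume x: "x = LeafU b"
      from ky show False
        by (elim disjE exE) (use xy yx x IU IV UV in auto)
    next
      fix b assume x: "x = LeafV b"
      from ky show False
        by (elim disjE exE) (use xy yx x IU IV UV in auto)
    qed
  qed
  then show ?thesis
    using a by (simp add: P_def)
qed

lemma overlap_replace_edge_le:
  assumes a: "admissible e x y"
  shows "overlap G (replace_edge G e {x, y}) \<le> max_overlap"
proof -
  have "e \<in> edges G"
    using a by (simp add: admissible_def)
  then show ?thesis
  proof (cases rule: edgeE)
    case (start i)
    then show ?thesis
      using overlap_start a by simp
  next
    case (leafU b)
    then show ?thesis
      using overlap_leafU a by simp
  next
    case (leafV b)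
    then have "mirror k ` e = {HubU, LeafU b}"
      by simp
    then show ?thesis
      using overlap_leafU[OF _ leafV(2)] admissible_mirror[OF a] by metis
  next
    case (path i j)
    then show ?thesis
      using overlap_path a by simp
  next
    case (stop i j)
    then have "k - Suc j = Suc 0"
      by linarith
    then have "mirror k ` e = {HubU, Inner i (Suc 0)}"
      using stop(1) by (simp add: insert_commute)
    then show ?thesis
      using overlap_start[OF _ stop(2)] admissible_mirror[OF a] by metis
  qed
qed

lemma overlap_le:
  assumes H: "simple_graph H" "\<not> graph_iso G H"
  shows "overlap G H \<le> max_overlap"
proof (cases "da_edeck G \<inter># da_edeck H = {#}")
  case True
  then show ?thesis
    by (simp add: overlap_def)
next
  case False
  then obtain c where "c \<in># da_edeck G \<inter># da_edeck H"
    by (auto simp: multiset_nonemptyE)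
  then have "c \<in># da_edeck G" "c \<in># da_edeck H"
    by (auto dest: mset_subset_eqD)
  then obtain e f where "e \<in> edges G" "f \<in> edges H" "da_ecard H f = da_ecard G e"
    using set_da_edeck[OF simple_G] set_da_edeck[OF H(1)] by auto
  then obtain x y where xy: "admissible e x y" "graph_iso H (replace_edge G e {x, y})"
    using da_ecard_eq_imp_admissible[OF H] by metis
  then show ?thesis
    using overlap_graph_iso[OF H(1) xy(2), of G] overlap_replace_edge_le[OF xy(1)] by simp
qed

end

section \<open>Graphs attaining the bound\<close>

lemma overlap_ge_1:
  assumes X: "simple_graph X" and Y: "simple_graph Y" and e: "e \<in> edges X" and f: "f \<in> edges Y"
    and eq: "da_ecard Y f = da_ecard X e"
  shows "1 \<le> overlap X Y"
proof -
  have "da_ecard X e \<in># da_edeck X"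
    unfolding set_da_edeck[OF X] using e by (rule imageI)
  moreover have "da_ecard X e \<in># da_edeck Y"
    unfolding set_da_edeck[OF Y] eq[symmetric] using f by (rule imageI)
  ultimately have "{#da_ecard X e#} \<subseteq># da_edeck X \<inter># da_edeck Y"
    by simp
  from size_mset_mono[OF this] show ?thesis
    by (simp add: overlap_def)
qed

lemma overlap_ge_2:
  assumes X: "simple_graph X" and Y: "simple_graph Y"
    and e: "e \<in> edges X" "e' \<in> edges X" "e \<noteq> e'" "da_ecard X e' = da_ecard X e"
    and f: "f \<in> edges Y" "f' \<in> edges Y" "f \<noteq> f'" "da_ecard Y f' = da_ecard Y f"
    and eq: "da_ecard Y f = da_ecard X e"
  shows "2 \<le> overlap X Y"
proof -
  have sub: "{#da_ecard Z g, da_ecard Z g'#} \<subseteq># da_edeck Z"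
    if "simple_graph Z" "g \<in> edges Z" "g' \<in> edges Z" "g \<noteq> g'" for Z :: "'z ugraph" and g g'
  proof -
    have "mset_set {g, g'} \<subseteq># mset_set (edges Z)"
      using that finite_edges[OF that(1)] by (intro subset_imp_msubset_mset_set) auto
    then have "image_mset (da_ecard Z) (mset_set {g, g'}) \<subseteq># da_edeck Z"
      unfolding da_edeck_def by (rule image_mset_subseteq_mono)
    then show ?thesis
      using that by simp
  qed
  have "{#da_ecard X e, da_ecard X e#} \<subseteq># da_edeck X \<inter># da_edeck Y"
    using sub[OF X e(1-3)] sub[OF Y f(1-3)] e(4) f(4) eq by simp
  from size_mset_mono[OF this] show ?thesis
    by (simp add: overlap_def)
qed

text \<open>Exchanges the paths 0 and 1, so the card of an edge on path 0 has a second copy in the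
  deck of the broom.\<close>

fun swap_paths :: "broom_vertex \<Rightarrow> broom_vertex" where
  "swap_paths (Inner i j) = Inner (if i = 0 then 1 else if i = 1 then 0 else i) j"
| "swap_paths z = z"

context broom
begin

lemma iso_map_swap_paths: "iso_map swap_paths G G"
proof (rule iso_map_involution[OF simple_G])
  show "swap_paths z \<in> verts G" if "z \<in> verts G" for z
    using that m_ge by (cases z) auto
  show "swap_paths (swap_paths z) = z" for z
    by (cases z) auto
  have arc: "arc n m k (swap_paths x) (swap_paths y)" if "arc n m k x y" for x y
    using that by (cases rule: arcE) (use m_ge in auto)
  show "{swap_paths x, swap_paths y} \<in> edges G" if "{x, y} \<in> edges G" for x y
    using that arc unfolding edge_iff by blast
qed

lemma not_iso_of_isolated:
  assumes H: "simple_graph H" and z: "z \<in> verts H" "deg H z = 0"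
  shows "\<not> graph_iso G H"
proof
  assume "graph_iso G H"
  then obtain f where f: "iso_map f H G"
    using graph_iso_sym[OF simple_G] by (auto simp: graph_iso_iff_iso_map)
  then have "f z \<in> verts G" "deg G (f z) = 0"
    using z iso_map_deg[OF H f] by (auto simp: iso_map_def bij_betw_def)
  then show False
    using m_ge by (cases "f z") (auto simp: deg_G)
qed

text \<open>\<open>LeafU 0\<close> stays isolated in \<open>H\<close>, whereas every vertex of
  \<open>G\<close> has positive degree.\<close>

lemma pendant_witness:
  assumes xy: "x \<in> verts G" "y \<in> verts G" "x \<noteq> y" "{x, y} \<notin> edges G"
    and ne: "x \<notin> {HubU, LeafU 0}" "y \<notin> {HubU, LeafU 0}" and sum: "deg G x + deg G y = m + n - 1"
  defines "H \<equiv> replace_edge G {HubU, LeafU 0} {x, y}"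
  shows "simple_graph H" "\<not> graph_iso G H" "da_ecard H {x, y} = da_ecard G {HubU, LeafU 0}"
    "{HubU, LeafU 0} \<in> edges G"
proof -
  show e: "{HubU, LeafU 0} \<in> edges G"
    using n_pos by (simp add: edge_iff)
  show H: "simple_graph H"
    unfolding H_def using xy by (intro simple_replace_edge simple_G)
  have "deg H (LeafU 0) = 0"
    using xy ne n_pos unfolding H_def
    by (subst deg_replace_edge[OF simple_G]) (auto simp: deg_delete_G[OF e] deg_G)
  then show "\<not> graph_iso G H"
    using n_pos by (intro not_iso_of_isolated[OF H, of "LeafU 0"]) (simp_all add: H_def)
  show "da_ecard H {x, y} = da_ecard G {HubU, LeafU 0}"
    unfolding H_def using xy ne sum n_pos
    by (intro da_ecard_replace_edge[OF simple_G e]) (auto simp: deg_delete_G[OF e] edge_degree_G)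
qed

text \<open>The cycle closed through \<open>HubU\<close> is a link with equal ends, which
  \<open>G\<close> does not have.\<close>

lemma path_to_leafU_witness:
  assumes j: "0 < j" "Suc (Suc j) < k"
  defines "H \<equiv> replace_edge G {Inner 0 j, Inner 0 (Suc j)} {Inner 0 j, LeafU 0}"
  shows "simple_graph H" "\<not> graph_iso G H"
    "da_ecard H {Inner 0 j, LeafU 0} = da_ecard G {Inner 0 j, Inner 0 (Suc j)}"
    "{Inner 0 j, Inner 0 (Suc j)} \<in> edges G"
proof -
  let ?e = "{Inner 0 j, Inner 0 (Suc j)}"
  have mn: "0 < m" "0 < n"
    using m_ge n_pos by auto
  show e: "?e \<in> edges G"
    using mn j by (simp add: edge_iff)
  have v: "Inner 0 j \<in> verts G" "LeafU 0 \<in> verts G" "Inner 0 j \<noteq> LeafU 0"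
    and new: "{Inner 0 j, LeafU 0} \<notin> edges G - {?e}"
    using mn j by (simp_all add: edge_iff)
  show H: "simple_graph H"
    unfolding H_def using v by (intro simple_replace_edge simple_G)
  have degH: "deg H z = deg G z - (if z \<in> ?e then 1 else 0) + (if z \<in> {Inner 0 j, LeafU 0} then 1 else 0)" for z
    unfolding H_def by (simp only: deg_replace_edge[OF simple_G v(3) new] deg_delete_G[OF e])
  have edge_H: "f \<in> edges H \<longleftrightarrow> f = {Inner 0 j, LeafU 0} \<or> f \<in> edges G \<and> f \<noteq> ?e" for f
    by (simp add: H_def)
  show "da_ecard H {Inner 0 j, LeafU 0} = da_ecard G ?e"
    unfolding H_def using v new mn j
    by (intro da_ecard_replace_edge[OF simple_G e]) (simp_all add: deg_delete_G[OF e] edge_degree_G deg_G)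
  define c where "c t = (if t = 0 \<or> t = Suc (Suc j) then HubU
    else if t = Suc j then LeafU 0 else Inner 0 t)" for t
  have c: "c 0 = HubU" "c (Suc (Suc j)) = HubU" "c (Suc j) = LeafU 0"
    "0 < t \<Longrightarrow> t \<le> j \<Longrightarrow> c t = Inner 0 t" for t
    by (auto simp: c_def)
  have "link H c (Suc (Suc j))"
    unfolding link_def
  proof (intro conjI allI impI)
    show "3 \<le> deg H (c 0)" "3 \<le> deg H (c (Suc (Suc j)))"
      using m_ge by (auto simp: c degH deg_G)
    show "{c t, c (Suc t)} \<in> edges H" if t: "t < Suc (Suc j)" for t
    proof -
      consider "t = 0" | "0 < t" "t < j" | "t = j" | "t = Suc j"
        using t by linarith
      then show ?thesis
        using mn j by cases (auto simp: edge_H c edge_iff doubleton_eq_iff)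
    qed
    show "deg H (c t) \<le> 2" if "0 < t \<and> t < Suc (Suc j)" for t
    proof (cases "t = Suc j")
      case True
      then show ?thesis
        using mn by (simp add: c degH deg_G)
    next
      case False
      then show ?thesis
        using that mn j by (simp add: c degH deg_G)
    qed
    show "c (Suc (Suc t)) \<noteq> c t" if "Suc (Suc t) \<le> Suc (Suc j)" for t
      using that j by (auto simp: c_def)
  qed simp
  then show "\<not> graph_iso G H"
    by (rule not_iso_of_link[OF H]) (simp add: c)
qed

text \<open>At position 2 the cycle is a quadrangle in which \<open>LeafU 0\<close> and
  \<open>Inner 0 1\<close> are twins, so their edges to \<open>Inner 0 2\<close> have the same card.
  In \<open>G\<close> the second copy comes from path 1. The deleted edge avoids \<open>HubV\<close>
  because \<open>k \<ge> 5\<close>.\<close>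

lemma ex_overlap_2_of_ge_5:
  assumes k: "5 \<le> k"
  shows "\<exists>H :: broom_vertex ugraph. simple_graph H \<and> \<not> graph_iso G H \<and> 2 \<le> overlap G H"
proof -
  define H where "H = replace_edge G {Inner 0 2, Inner 0 3} {Inner 0 2, LeafU 0}"
  have mn: "0 < m" "1 < m" "0 < n"
    using m_ge n_pos by auto
  have 3: "Suc 2 = 3"
    by simp
  have "Suc (Suc 2) < k"
    using k by simp
  note w = path_to_leafU_witness[OF pos2 this, unfolded 3, folded H_def]
  have nbH: "z \<in> nbrs H y \<longleftrightarrow> {y, z} = {Inner 0 2, LeafU 0} \<or> {y, z} \<noteq> {Inner 0 2, Inner 0 3} \<and> z \<in> nbrs G y" for y z
    unfolding H_def by (rule mem_nbrs_replace_edge)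
  have pv: "path_vertex k 0 0 = HubU" "path_vertex k 0 2 = Inner 0 2"
    using k by (simp_all add: path_vertex_def)
  have "nbrs G (Inner 0 1) = {path_vertex k 0 (1 - 1), path_vertex k 0 (Suc 1)}"
    using mn k by (intro nbrs_G(3)) simp_all
  then have nbG: "nbrs G (Inner 0 1) = {HubU, Inner 0 2}" "nbrs G (LeafU 0) = {HubU}"
    using nbrs_G(4)[of 0] mn pv by (simp_all add: numeral_2_eq_2)
  have twins: "nbrs H (LeafU 0) = nbrs H (Inner 0 1)"
  proof (rule set_eqI)
    fix z show "z \<in> nbrs H (LeafU 0) \<longleftrightarrow> z \<in> nbrs H (Inner 0 1)"
      unfolding nbH nbG doubleton_eq_iff by (cases z) simp_all
  qed
  have new: "{Inner 0 2, LeafU 0} \<in> edges H"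
    by (simp add: H_def)
  have "Inner 0 2 \<in> nbrs H (Inner 0 1)"
    unfolding nbH nbG doubleton_eq_iff by simp
  then have new': "{Inner 0 2, Inner 0 1} \<in> edges H"
    by (simp add: nbrs_def doubleton_commute)
  have v: "LeafU 0 \<in> verts H" "Inner 0 1 \<in> verts H"
    using mn k by (simp_all add: H_def)
  show ?thesis
  proof (intro exI[of _ H] conjI)
    show "2 \<le> overlap G H"
    proof (rule overlap_ge_2[OF simple_G w(1) w(4) _ _ _ new new'])
      show "da_ecard H {Inner 0 2, Inner 0 1} = da_ecard H {Inner 0 2, LeafU 0}"
        by (rule da_ecard_twins[OF w(1) v twins new])
      show "da_ecard G {Inner 1 2, Inner 1 3} = da_ecard G {Inner 0 2, Inner 0 3}"
        using iso_map_da_ecard[OF simple_G iso_map_swap_paths w(4)] by simp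
      show "{Inner 1 2, Inner 1 3} \<in> edges G"
        unfolding edge_iff using mn k by simp
    qed (simp_all add: w(3) doubleton_eq_iff)
  qed (rule w)+
qed

text \<open>The new edge closes a quadrangle through \<open>HubV\<close> in which
  \<open>LeafV 0\<close> and \<open>Inner 0 2\<close> are twins. In \<open>G\<close> the second copy
  of the card comes from the reflected pendant edge. The new ends have degrees 2 and 1 in the card,
  which requires \<open>m + n - 1 = 3\<close>.\<close>

lemma ex_overlap_2_of_eq_4:
  assumes k: "k = 4" and mn4: "m + n = 4"
  shows "\<exists>H :: broom_vertex ugraph. simple_graph H \<and> \<not> graph_iso G H \<and> 2 \<le> overlap G H"
proof -
  define H where "H = replace_edge G {HubU, LeafU 0} {Inner 0 1, LeafV 0}"
  have mn: "0 < m" "0 < n" and k4: "Suc 2 < k" "k \<le> 4"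
    using m_ge n_pos k by auto
  have v: "Inner 0 1 \<in> verts G" "LeafV 0 \<in> verts G" "Inner 0 2 \<in> verts G"
    using mn k4 by simp_all
  have "deg G (Inner 0 1) = 2" "deg G (LeafV 0) = 1"
    using deg_G(3)[of 0 1] deg_G(5)[of 0] mn k4 by simp_all
  then have sum: "deg G (Inner 0 1) + deg G (LeafV 0) = m + n - 1"
    using mn4 by simp
  have "{Inner 0 1, LeafV 0} \<notin> edges G"
    by (simp add: edge_iff)
  note w = pendant_witness[OF v(1,2) _ this _ _ sum, folded H_def, simplified]
  have nbH: "z \<in> nbrs H y \<longleftrightarrow> {y, z} = {Inner 0 1, LeafV 0} \<or> {y, z} \<noteq> {HubU, LeafU 0} \<and> z \<in> nbrs G y" for y z
    unfolding H_def by (rule mem_nbrs_replace_edge)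
  have pv: "path_vertex k 0 1 = Inner 0 1" "path_vertex k 0 3 = HubV"
    using k4 by (simp_all add: path_vertex_def)
  have "nbrs G (Inner 0 2) = {path_vertex k 0 (2 - 1), path_vertex k 0 (Suc 2)}"
    using mn k4 by (intro nbrs_G(3)) simp_all
  then have nbG: "nbrs G (Inner 0 2) = {Inner 0 1, HubV}" "nbrs G (LeafV 0) = {HubV}"
    using nbrs_G(5)[of 0] mn pv by simp_all
  have twins: "nbrs H (LeafV 0) = nbrs H (Inner 0 2)"
  proof (rule set_eqI)
    fix z show "z \<in> nbrs H (LeafV 0) \<longleftrightarrow> z \<in> nbrs H (Inner 0 2)"
      unfolding nbH nbG doubleton_eq_iff by (cases z) auto
  qed
  have new: "{Inner 0 1, LeafV 0} \<in> edges H"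
    by (simp add: H_def)
  have "Inner 0 1 \<in> nbrs H (Inner 0 2)"
    unfolding nbH nbG doubleton_eq_iff by simp
  then have new': "{Inner 0 1, Inner 0 2} \<in> edges H"
    by (simp add: nbrs_def doubleton_commute)
  have vH: "LeafV 0 \<in> verts H" "Inner 0 2 \<in> verts H"
    using v by (simp_all add: H_def)
  show ?thesis
  proof (intro exI[of _ H] conjI)
    show "2 \<le> overlap G H"
    proof (rule overlap_ge_2[OF simple_G w(1) w(4) _ _ _ new new'])
      show "da_ecard H {Inner 0 1, Inner 0 2} = da_ecard H {Inner 0 1, LeafV 0}"
        by (rule da_ecard_twins[OF w(1) vH twins new])
      show "da_ecard G {HubV, LeafV 0} = da_ecard G {HubU, LeafU 0}"
        using iso_map_da_ecard[OF simple_G iso_map_mirror w(4)] by simp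
      show "{HubV, LeafV 0} \<in> edges G"
        using mn by (simp add: edge_iff)
    qed (use w(3) in \<open>simp_all add: doubleton_eq_iff\<close>)
  qed (rule w)+
qed

lemma ex_overlap_1_of_ge_4:
  assumes "4 \<le> k"
  shows "\<exists>H :: broom_vertex ugraph. simple_graph H \<and> \<not> graph_iso G H \<and> 1 \<le> overlap G H"
proof -
  have "Suc (Suc 1) < k"
    using assms by simp
  note w = path_to_leafU_witness[OF zero_less_one this]
  have "1 \<le> overlap G (replace_edge G {Inner 0 1, Inner 0 (Suc 1)} {Inner 0 1, LeafU 0})"
    by (rule overlap_ge_1[OF simple_G w(1) w(4) _ w(3)]) simp
  with w(1,2) show ?thesis
    by blast
qed

lemma ex_overlap_1_of_le_5:
  assumes "m + n \<le> 5"
  shows "\<exists>H :: broom_vertex ugraph. simple_graph H \<and> \<not> graph_iso G H \<and> 1 \<le> overlap G H"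
proof -
  have mn: "0 < m" "1 < m" "0 < n"
    using m_ge n_pos by auto
  have d: "deg G (Inner 0 1) = 2" "deg G (Inner 1 1) = 2" "deg G (LeafV 0) = 1"
    using deg_G(3)[of 0 1] deg_G(3)[of 1 1] deg_G(5)[of 0] mn k_ge by simp_all
  \<comment> \<open>The degrees must add up to \<open>m + n - 1\<close>, which is 2 + 2 with an
    inner vertex of another path or 2 + 1 with a leaf.\<close>
  obtain y where y: "y \<in> verts G" "{Inner 0 1, y} \<notin> edges G" "y \<notin> {HubU, LeafU 0}" "Inner 0 1 \<noteq> y"
    "deg G (Inner 0 1) + deg G y = m + n - 1"
  proof (cases "m + n = 5")
    case True
    then show thesis
      using that[of "Inner 1 1"] d mn k_ge by (simp add: edge_iff)
  next
    case False
    then have "m + n = 4"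
      using assms m_ge n_pos by linarith
    then show thesis
      using that[of "LeafV 0"] d mn by (simp add: edge_iff)
  qed
  have "Inner 0 1 \<in> verts G" "Inner 0 1 \<notin> {HubU, LeafU 0}"
    using mn k_ge by simp_all
  note w = pendant_witness[OF this(1) y(1,4,2) this(2) y(3,5)]
  have "1 \<le> overlap G (replace_edge G {HubU, LeafU 0} {Inner 0 1, y})"
    by (rule overlap_ge_1[OF simple_G w(1) w(4) _ w(3)]) simp
  with w(1,2) show ?thesis
    by blast
qed

lemma ex_max_overlap:
  assumes "max_overlap \<noteq> 0"
  shows "\<exists>H :: broom_vertex ugraph. simple_graph H \<and> \<not> graph_iso G H \<and> max_overlap \<le> overlap G H"
proof (cases "5 \<le> k \<or> k = 4 \<and> m + n = 4")
  case True
  then have "max_overlap = 2"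
    unfolding max_overlap_def by (rule if_P)
  then show ?thesis
    using True ex_overlap_2_of_ge_5 ex_overlap_2_of_eq_4 by metis
next
  case False
  then have "max_overlap = (if k = 4 \<or> m + n \<le> 5 then 1 else 0)"
    unfolding max_overlap_def by (rule if_not_P)
  with assms have one: "max_overlap = 1" and "k = 4 \<or> m + n \<le> 5"
    by (simp_all split: if_splits)
  from this(2) show ?thesis
    unfolding one
  proof
    assume "k = 4"
    then show "\<exists>H :: broom_vertex ugraph. simple_graph H \<and> \<not> graph_iso G H \<and> 1 \<le> overlap G H"
      by (intro ex_overlap_1_of_ge_4) simp
  qed (rule ex_overlap_1_of_le_5)
qed

text \<open>As \<open>max_overlap\<close> is at most 2, three edges ensure that families of
  \<open>Suc max_overlap\<close> cards exist.\<close>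

lemma three_le_card_edges: "3 \<le> card (edges G)"
proof -
  have "{{HubU, Inner i (Suc 0)} |i. i < m} \<subseteq> edges G"
    using k_ge by (auto simp: edge_iff)
  then have "(\<lambda>i. {HubU, Inner i (Suc 0)}) ` {..<m} \<subseteq> edges G"
    by auto
  then have "card ((\<lambda>i. {HubU, Inner i (Suc 0)}) ` {..<m}) \<le> card (edges G)"
    by (intro card_mono finite_edges simple_G)
  moreover have "card ((\<lambda>i. {HubU, Inner i (Suc 0)}) ` {..<m}) = m"
    by (subst card_image) (auto simp: inj_on_def doubleton_eq_iff)
  ultimately show ?thesis
    using m_ge by simp
qed

lemma adern_G: "adern G = enat (Suc max_overlap)"
proof (cases "max_overlap = 0")
  case False
  then obtain H :: "broom_vertex ugraph" where H: "simple_graph H" "\<not> graph_iso G H" "max_overlap \<le> overlap G H"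
    using ex_max_overlap by blast
  have "max_overlap < card (edges G)"
    using three_le_card_edges by (auto simp: max_overlap_def)
  then show ?thesis
    using adern_eqI[OF simple_G H] overlap_le by blast
next
  case True
  moreover have "overlap G H = 0" if "simple_graph H" "\<not> graph_iso G H" for H :: "nat ugraph"
    using overlap_le[OF that] True by simp
  moreover have "edges G \<noteq> {}"
    using three_le_card_edges by auto
  ultimately show ?thesis
    using adern_eq_1I[OF _ simple_G] by (simp add: one_enat_def)
qed

end

theorem theorem3p2:
  fixes n m k :: nat and G :: "broom_vertex ugraph"
  assumes "n \<ge> 1" and "m \<ge> 3" and "k \<ge> 3"
    and "G = strong_double_broom n n m k"
  shows "adern G =
    (if k \<ge> 5 \<or> (m = 3 \<and> k = 4 \<and> n = 1) then 3
     else if (m = 3 \<and> k = 3 \<and> n + 1 = 3)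
        \<or> (m = 4 \<and> k + 1 = 4 \<and> n + 3 = 4)
        \<or> (m = 3 \<and> k = 3 \<and> n + 2 = 3)
        \<or> (m \<ge> k \<and> k = 4)
        \<or> (m = 3 \<and> k - 1 = 3 \<and> n \<ge> 2) then 2
     else 1)"
proof -
  interpret broom n m k
    by unfold_locales (rule assms)+
  let ?three = "k \<ge> 5 \<or> (m = 3 \<and> k = 4 \<and> n = 1)"
  let ?two = "(m = 3 \<and> k = 3 \<and> n + 1 = 3) \<or> (m = 4 \<and> k + 1 = 4 \<and> n + 3 = 4)
    \<or> (m = 3 \<and> k = 3 \<and> n + 2 = 3) \<or> (m \<ge> k \<and> k = 4) \<or> (m = 3 \<and> k - 1 = 3 \<and> n \<ge> 2)"
  have three: "5 \<le> k \<or> k = 4 \<and> m + n = 4 \<longleftrightarrow> ?three"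
    using assms(1-3) by arith
  have two: "k = 4 \<or> m + n \<le> 5 \<longleftrightarrow> ?two" if "\<not> ?three"
  proof -
    have "k = 3 \<or> k = 4"
      using that assms(3) by linarith
    then show ?thesis
    proof
      assume k: "k = 3"
      have "m + n \<le> 5 \<longleftrightarrow> m = 3 \<and> n = 2 \<or> m = 4 \<and> n = 1 \<or> m = 3 \<and> n = 1"
        using assms(1,2) by arith
      then show ?thesis
        unfolding k by simp
    next
      assume k: "k = 4"
      \<comment> \<open>For \<open>k = 4\<close> the two alternatives exhaust everything outside the
        case with value 3.\<close>
      have "4 \<le> m \<or> m = 3 \<and> 2 \<le> n"
        using that assms(1,2) k by linarith
      then show ?thesis
        unfolding k by auto
    qed
  qed
  have "adern G = enat (Suc max_overlap)"
    unfolding assms(4) by (rule adern_G)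
  also have "\<dots> = (if ?three then 3 else if ?two then 2 else 1)"
  proof (cases ?three)
    case True
    then have "max_overlap = 2"
      unfolding max_overlap_def three by (rule if_P)
    then show ?thesis
      unfolding if_P[OF True] by (simp add: numeral_eq_enat)
  next
    case False
    then have "max_overlap = (if ?two then 1 else 0)"
      unfolding max_overlap_def three two[OF False] by (rule if_not_P)
    then show ?thesis
      unfolding if_not_P[OF False] by (simp only: split: if_split) (simp add: numeral_eq_enat one_enat_def)
  qed
  finally show ?thesis .
qed

end
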